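(* Let $\boldsymbol\omega\in\mathbb{C}^{d^n}$ be a complex random matrix product state (rMPS) of order $n$, physical dimension $d$ and bond dimension $\chi$. (1) The fourth-moment tensor $\mathcal M^{\mathbb C}=\mathbb{E}[\boldsymbol\omega^{\otimes2}\otimes\overline{\boldsymbol\omega}^{\otimes2}]$ is given, for all multi-indices $\boldsymbol i,\boldsymbol j,\boldsymbol k,\boldsymbol\ell\in\{1,\dots,d\}^n$, by $$\mathcal M^{\mathbb C}(\boldsymbol i,\boldsymbol j,\boldsymbol k,\boldsymbol\ell)=\sum_{\alpha_1,\dots,\alpha_n=1}^{2}\ \prod_{p=1}^{n}\mathcal W^{\mathbb C}_d(i_p,j_p,k_p,\ell_p,\alpha_p)\ \prod_{p=1}^{n-1}\mathbf T^{\mathbb C}(\alpha_p,\alpha_{p+1}),\qquad \mathbf T^{\mathbb C}=\begin{bmatrix}1&1/\chi\\1/\chi&1\end{bmatrix}.$$ (2) Sample $b_1,\dots,b_{n-1}\sim\mathrm{Bernoulli}(1/\chi)$ iid, let $\boldsymbol s=(s_1,\dots,s_t)$ be the corresponding composition of $n$, and let $\boldsymbol h_{\boldsymbol b}=\boldsymbol g^{(1)}\otimes\boldsymbol g^{(2)}\otimes\cdots\otimes\boldsymbol g^{(t)}$ where, conditionally on $\boldsymbol b$, the vectors $\boldsymbol g^{(q)}\sim\mathcal N_{\mathbb C}(\boldsymbol0,\mathbf I_{d^{s_q}})$ are independent. Then the first four moments of $\boldsymbol\omega$ and $\boldsymbol h_{\boldsymbol b}$ agree: $$\mathbb{E}[\boldsymbol\omega]=\mathbb{E}[\boldsymbol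 h_{\boldsymbol b}]=\boldsymbol0,\quad \mathbb{E}[\boldsymbol\omega\boldsymbol\omega^*]=\mathbb{E}[\boldsymbol h_{\boldsymbol b}\boldsymbol h_{\boldsymbol b}^*]=\mathbf I,\quad \mathbb{E}[\boldsymbol\omega^{\otimes3}]=\mathbb{E}[\boldsymbol h_{\boldsymbol b}^{\otimes3}]=\boldsymbol0,\quad \mathbb{E}[\boldsymbol\omega^{\otimes2}\otimes\overline{\boldsymbol\omega}^{\otimes2}]=\mathbb{E}[\boldsymbol h_{\boldsymbol b}^{\otimes2}\otimes\overline{\boldsymbol h}_{\boldsymbol b}^{\otimes2}].$$ (3) Consequently, for any matrix $\mathbf A\in\mathbb{C}^{d^n\times d^n}$, $$\operatorname{Var}(\boldsymbol\omega^*\mathbf A\boldsymbol\omega)\le\|\mathbf A\|_{\rm F}^2+2\left[\left(1+\frac1\chi\right)^{n-1}-1\right]\|\mathbf A\|_*^2 .$$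
   Context: $\mathcal N_{\mathbb C}(0,\sigma^2)$ is the law of $g_1+\mathrm{i}g_2$ with $g_1,g_2$ independent $\mathcal N_{\mathbb R}(0,\sigma^2/2)$; $\mathcal N_{\mathbb C}(\boldsymbol0,\mathbf I_m)$ is the law of a vector of $m$ iid $\mathcal N_{\mathbb C}(0,1)$ entries. $\operatorname{Var}(x)=\mathbb{E}[|x|^2]-|\mathbb{E}[x]|^2$; $\|\cdot\|_{\rm F}$ and $\|\cdot\|_*$ are the Frobenius and nuclear norms. Entrywise, $\mathcal M^{\mathbb C}(\boldsymbol i,\boldsymbol j,\boldsymbol k,\boldsymbol\ell)=\mathbb{E}[\boldsymbol\omega(\boldsymbol i)\boldsymbol\omega(\boldsymbol j)\overline{\boldsymbol\omega(\boldsymbol k)\boldsymbol\omega(\boldsymbol\ell)}]$. The complex Wick tensor $\mathcal W_d^{\mathbb C}\in\{0,1\}^{d\times d\times d\times d\times2}$ is $\mathcal W_d^{\mathbb C}(i,j,k,\ell,1)=\mathbb 1_{\{i=k\}}\mathbb 1_{\{j=\ell\}}$, $\mathcal W_d^{\mathbb C}(i,j,k,\ell,2)=\mathbb 1_{\{i=\ell\}}\mathbb 1_{\{j=k\}}$. Let $d,\chi\ge1$ and $n\ge2$ be integers. A complex rMPS of order $n$, physical dimension $d$ and bond dimension $\chi$ is the random vector $\boldsymbol\omega\in\mathbb{C}^{d^n}$ with entries $$\boldsymbol\omega(i_1,\dots,i_n)=\sum_{\alpha_1,\dots,\alpha_{n-1}=1}^{\chi}G_1(i_1,\alpha_1)\,G_2(\alpha_1,i_2,\alpha_2)\cdots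 G_{n-1}(\alpha_{n-2},i_{n-1},\alpha_{n-1})\,G_n(\alpha_{n-1},i_n),\quad (i_1,\dots,i_n)\in\{1,\dots,d\}^n,$$ where $G_1\in\mathbb{C}^{d\times\chi}$, $G_n\in\mathbb{C}^{\chi\times d}$, $G_p\in\mathbb{C}^{\chi\times d\times\chi}$ for $1<p<n$, and all entries of all cores are independent, those of $G_p$ having law $\mathcal N_{\mathbb C}(0,\sigma_p^2)$ with $\sigma_p^2=1/\chi$ for $1<p<n$ and $\sigma_p^2=1/\sqrt\chi$ for $p\in\{1,n\}$. Composition associated with $\boldsymbol b\in\{0,1\}^{n-1}$: let $p_1<\dots<p_{t-1}$ be the indices $p$ with $b_p=1$ (so $t=1+|\{p:b_p=1\}|$), put $p_0=0$, $p_t=n$, and $s_q=p_q-p_{q-1}$ for $q=1,\dots,t$. The tensor product $\boldsymbol g^{(1)}\otimes\cdots\otimes\boldsymbol g^{(t)}$ is viewed as a vector in $\mathbb{C}^{d^n}$ indexed by $\{1,\dots,d\}^n$: its $(i_1,\dots,i_n)$ entry is $\prod_{q=1}^t\boldsymbol g^{(q)}(i_{p_{q-1}+1},\dots,i_{p_q})$, where $\boldsymbol g^{(q)}\in\mathbb{C}^{d^{s_q}}$ is indexed by $\{1,\dots,d\}^{s_q}$. *)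

theory Defs
  imports "HOL-Probability.Probability" "Jordan_Normal_Form.Schur_Decomposition"
begin

text \<open>
  A random vector indexed by a set of multi-indices is a function \<open>w\<close> with \<open>w i x\<close> the entry \<open>i\<close> at the sample point \<open>x\<close>, and expectations are
  stated with \<open>has_bochner_integral\<close> (or with an explicit \<open>integrable\<close>), so that no claim
  rests on the default value of the integral of a non-integrable function.
\<close>

subsection \<open>Complex Gaussian laws\<close>

definition complex_normal :: "real \<Rightarrow> complex measure" where
  "complex_normal v =
     (let N = density lborel (\<lambda>u. ennreal (normal_density 0 (sqrt (v / 2)) u))
      in distr (N \<Otimes>\<^sub>M N) borel
           (\<lambda>(u1, u2). complex_of_real u1 + \<i> * complex_of_real u2))"

definition indep_complex_normals ::
    "'x measure \<Rightarrow> ('k \<Rightarrow> 'x \<Rightarrow> complex) \<Rightarrow> ('k \<Rightarrow> real) \<Rightarrow> 'k set \<Rightarrow> bool" where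
  "indep_complex_normals M Z v K \<longleftrightarrow>
     prob_space M \<and>
     prob_space.indep_vars M (\<lambda>_. borel) Z K \<and>
     (\<forall>k\<in>K. distr M borel (Z k) = complex_normal (v k))"

subsection \<open>Complex random matrix product states\<close>

definition multi_indices :: "nat \<Rightarrow> nat \<Rightarrow> (nat \<Rightarrow> nat) set" where
  "multi_indices d n = {1..n} \<rightarrow>\<^sub>E {1..d}"

text \<open>
  A core family is a function \<open>G\<close>; for \<open>1 < p < n\<close> the entry \<open>G\<^sub>p(\<alpha>, i, \<beta>)\<close> is \<open>G (p, \<alpha>, i, \<beta>)\<close>.
  The end cores have a dummy bond index fixed to \<open>1\<close>: \<open>G\<^sub>1(i, \<beta>)\<close> is \<open>G (1, 1, i, \<beta>)\<close> and
  \<open>G\<^sub>n(\<alpha>, i)\<close> is \<open>G (n, \<alpha>, i, 1)\<close>.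
\<close>

definition core_entries :: "nat \<Rightarrow> nat \<Rightarrow> nat \<Rightarrow> (nat \<times> nat \<times> nat \<times> nat) set" where
  "core_entries d chi n =
     {(p, \<alpha>, i, \<beta>). p \<in> {1..n} \<and> i \<in> {1..d} \<and>
        \<alpha> \<in> (if p = 1 then {1} else {1..chi}) \<and>
        \<beta> \<in> (if p = n then {1} else {1..chi})}"

definition core_variance :: "nat \<Rightarrow> nat \<Rightarrow> nat \<Rightarrow> real" where
  "core_variance chi n p = (if 1 < p \<and> p < n then 1 / real chi else 1 / sqrt (real chi))"

definition random_cores ::
    "'x measure \<Rightarrow> nat \<Rightarrow> nat \<Rightarrow> nat \<Rightarrow> (nat \<times> nat \<times> nat \<times> nat \<Rightarrow> 'x \<Rightarrow> complex) \<Rightarrow> bool" where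
  "random_cores M d chi n G \<longleftrightarrow>
     indep_complex_normals M G (\<lambda>(p, _). core_variance chi n p) (core_entries d chi n)"

definition mps ::
    "nat \<Rightarrow> nat \<Rightarrow> (nat \<times> nat \<times> nat \<times> nat \<Rightarrow> 'x \<Rightarrow> complex) \<Rightarrow>
     (nat \<Rightarrow> nat) \<Rightarrow> 'x \<Rightarrow> complex" where
  "mps chi n G i x =
     (\<Sum>\<alpha> \<in> {1..n-1} \<rightarrow>\<^sub>E {1..chi}.
        G (1, 1, i 1, \<alpha> 1) x *
        (\<Prod>p=2..n-1. G (p, \<alpha> (p-1), i p, \<alpha> p) x) *
        G (n, \<alpha> (n-1), i n, 1) x)"

subsection \<open>The complex Wick tensor and the transfer matrix\<close>

text \<open>The last index of the Wick tensor and both indices of the transfer matrix are in \<open>{1, 2}\<close>.\<close>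

definition wick_tensor :: "nat \<Rightarrow> nat \<Rightarrow> nat \<Rightarrow> nat \<Rightarrow> nat \<Rightarrow> complex" where
  "wick_tensor i j k l a =
     (if a = 1 then of_bool (i = k) * of_bool (j = l)
      else of_bool (i = l) * of_bool (j = k))"

definition transfer_matrix :: "nat \<Rightarrow> nat \<Rightarrow> nat \<Rightarrow> complex" where
  "transfer_matrix chi a b = (if a = b then 1 else 1 / of_nat chi)"

subsection \<open>Random compositions and Gaussian tensor products\<close>

text \<open>
  For \<open>\<beta>\<close> in \<open>{0,1}\<^sup>n\<^sup>-\<^sup>1\<close>, read as a predicate on \<open>{1..n-1}\<close>: the number \<open>t\<close> of parts, the
  break points \<open>0 = p\<^sub>0 < p\<^sub>1 < ... < p\<^sub>t = n\<close> and the parts \<open>s\<^sub>q\<close>, \<open>q = 1..t\<close>.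
\<close>

definition num_parts :: "nat \<Rightarrow> (nat \<Rightarrow> bool) \<Rightarrow> nat" where
  "num_parts n \<beta> = 1 + card {p \<in> {1..n-1}. \<beta> p}"

definition break_point :: "nat \<Rightarrow> (nat \<Rightarrow> bool) \<Rightarrow> nat \<Rightarrow> nat" where
  "break_point n \<beta> q = (0 # filter \<beta> [1..<n] @ [n]) ! q"

definition part_size :: "nat \<Rightarrow> (nat \<Rightarrow> bool) \<Rightarrow> nat \<Rightarrow> nat" where
  "part_size n \<beta> q = break_point n \<beta> q - break_point n \<beta> (q - 1)"

definition composition_tensor ::
    "nat \<Rightarrow> (nat \<Rightarrow> bool) \<Rightarrow> (nat \<Rightarrow> (nat \<Rightarrow> nat) \<Rightarrow> complex) \<Rightarrow> (nat \<Rightarrow> nat) \<Rightarrow> complex" where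
  "composition_tensor n \<beta> g i =
     (\<Prod>q=1..num_parts n \<beta>.
        g q (\<lambda>r\<in>{1..part_size n \<beta> q}. i (break_point n \<beta> (q - 1) + r)))"

text \<open>
  Since \<open>b\<close> is discrete, conditioning on \<open>b = \<beta>\<close> is passing to the normalised restriction of
  \<open>N\<close> to that event, for every \<open>\<beta>\<close> of positive probability. The vector \<open>g q\<close> has a random
  dimension: its entries \<open>g q i\<close> are given for multi-indices \<open>i\<close> of every length that part \<open>q\<close>
  can have. They are random variables also if that length has probability zero
  (\<open>chi = 1\<close>), so that the tensor product is measurable.
\<close>

definition random_composition_gaussians ::
    "'y measure \<Rightarrow> nat \<Rightarrow> nat \<Rightarrow> nat \<Rightarrow> (nat \<Rightarrow> 'y \<Rightarrow> bool) \<Rightarrow>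
     (nat \<Rightarrow> (nat \<Rightarrow> nat) \<Rightarrow> 'y \<Rightarrow> complex) \<Rightarrow> bool" where
  "random_composition_gaussians N d chi n b g \<longleftrightarrow>
     prob_space N \<and>
     prob_space.indep_vars N (\<lambda>_. count_space UNIV) b {1..n-1} \<and>
     (\<forall>p\<in>{1..n-1}. distr N (count_space UNIV) (b p) = measure_pmf (bernoulli_pmf (1 / real chi))) \<and>
     (\<forall>\<beta>. let
          E = {y \<in> space N. \<forall>p\<in>{1..n-1}. b p y = \<beta> p};
          K = (SIGMA q:{1..num_parts n \<beta>}. multi_indices d (part_size n \<beta> q))
        in (\<forall>(q, i)\<in>K. g q i \<in> borel_measurable N) \<and>
           (measure N E > 0 \<longrightarrow>
              indep_complex_normals (uniform_measure N E) (\<lambda>(q, i). g q i) (\<lambda>_. 1) K))"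

definition random_composition_tensor ::
    "nat \<Rightarrow> (nat \<Rightarrow> 'y \<Rightarrow> bool) \<Rightarrow> (nat \<Rightarrow> (nat \<Rightarrow> nat) \<Rightarrow> 'y \<Rightarrow> complex) \<Rightarrow>
     (nat \<Rightarrow> nat) \<Rightarrow> 'y \<Rightarrow> complex" where
  "random_composition_tensor n b g i y =
     composition_tensor n (\<lambda>p. b p y) (\<lambda>q i'. g q i' y) i"

subsection \<open>Matrix norms, quadratic forms and the complex variance\<close>

definition frobenius_norm :: "complex mat \<Rightarrow> real" where
  "frobenius_norm A = sqrt (\<Sum>a<dim_row A. \<Sum>b<dim_col A. (cmod (A $$ (a, b)))\<^sup>2)"

text \<open>
  Square roots of the eigenvalues of \<open>A\<^sup>* A\<close>, counted with algebraic multiplicity. These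
  eigenvalues are real and nonnegative, so that \<open>Re\<close> discards nothing. For rectangular
  \<open>A\<close> the multiset has \<open>dim_col A\<close> elements; surplus ones are zero.
\<close>

definition singular_values :: "complex mat \<Rightarrow> real multiset" where
  "singular_values A =
     image_mset (\<lambda>z. sqrt (Re z)) (proots (char_poly (mat_adjoint A * A)))"

definition nuclear_norm :: "complex mat \<Rightarrow> real" where
  "nuclear_norm A = sum_mset (singular_values A)"

text \<open>
  The multi-index numbered \<open>a < d^n\<close>, from the base-\<open>d\<close> digits of \<open>a\<close>. It identifies vectors
  indexed by \<open>multi_indices d n\<close> with library vectors of dimension \<open>d^n\<close>.
\<close>

definition nth_multi_index :: "nat \<Rightarrow> nat \<Rightarrow> nat \<Rightarrow> (nat \<Rightarrow> nat)" where
  "nth_multi_index d n a = (\<lambda>p\<in>{1..n}. 1 + (a div d ^ (p - 1)) mod d)"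

definition flatten :: "nat \<Rightarrow> nat \<Rightarrow> ((nat \<Rightarrow> nat) \<Rightarrow> complex) \<Rightarrow> complex Matrix.vec" where
  "flatten d n w = Matrix.vec (d ^ n) (\<lambda>a. w (nth_multi_index d n a))"

text \<open>\<open>v\<^sup>* A v\<close>; the product \<open>u \<bullet>c v\<close> conjugates its second argument.\<close>

definition quad_form :: "complex mat \<Rightarrow> complex Matrix.vec \<Rightarrow> complex" where
  "quad_form A v = (A *\<^sub>v v) \<bullet>c v"

definition complex_variance :: "'x measure \<Rightarrow> ('x \<Rightarrow> complex) \<Rightarrow> real" where
  "complex_variance M X = (\<integral>x. (cmod (X x))\<^sup>2 \<partial>M) - (cmod (\<integral>x. X x \<partial>M))\<^sup>2"

end

theory Submission
  imports Defs
begin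

text \<open>
  \<^bold>\<open>Moments of the matrix product state.\<close> An entry of \<open>\<omega>\<close> is a sum over bond indices of products
  with one factor from each core. The cores are independent, so the expectation of a product of
  entries factorises over the cores, and for four entries Wick's formula makes the factor of core
  \<open>p\<close> a sum over the two matchings \<open>\<alpha>\<^sub>p \<in> {1, 2}\<close> of the two plain with the two conjugated
  entries. A matching demands equalities between physical indices, which are the Wick tensor, and
  between the bond indices on either side of the core. The four bond indices at position
  \<open>p < n\<close> are constrained by the matchings of cores \<open>p\<close> and \<open>p + 1\<close> only: they can be
  chosen in \<open>chi\<^sup>2\<close> ways if these agree and in \<open>chi\<close> ways if they differ. The squared
  variances multiply to \<open>chi\<close> to the power \<open>-2(n - 1)\<close>, so that each position \<open>p < n\<close> is left
  with the transfer matrix (\<open>mps_fourth_moment\<close>).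

  \<^bold>\<open>Moments of the random tensor product.\<close> Given the composition, Wick's formula gives a matching to
  every part: a matching for every \<open>p \<le> n\<close> that changes only where \<open>b\<^sub>p = 1\<close>
  (\<open>sum_colourings_of_parts\<close>). The probability that \<open>b\<close> allows the matchings
  \<open>\<alpha>\<close> is a product over \<open>p < n\<close> of \<open>1\<close> if \<open>\<alpha>\<^sub>p = \<alpha>\<^sub>p\<^sub>+\<^sub>1\<close> and of \<open>1/chi\<close> otherwise,
  which is the same product of transfer matrix entries.

  \<^bold>\<open>Variance.\<close> By the fourth moments, \<open>E|\<omega>\<^sup>* A \<omega>|\<^sup>2\<close> is a sum over the sequences \<open>\<alpha>\<close> of
  the transfer weight of \<open>\<alpha>\<close> times a contraction of \<open>A\<close> with its conjugate. The two constant
  sequences have weight \<open>1\<close> and contribute \<open>|tr A|\<^sup>2\<close>, which is the squared modulus of the mean, and the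
  squared Frobenius norm. The weights of the other sequences sum to
  \<open>2(1 + 1/chi)\<^sup>n\<^sup>-\<^sup>1 - 2\<close>, and each contraction is at most the squared nuclear norm
  (\<open>norm_wick_contraction_le\<close>): with \<open>A = \<Sum>\<^sub>r w\<^sub>r v\<^sub>r\<^sup>*\<close>, where the \<open>v\<^sub>r\<close> are unit vectors and
  the norms of the \<open>w\<^sub>r\<close> sum to the nuclear norm (\<open>rank_one_decomposition\<close>), the contraction
  pairs the entries of \<open>w\<^sub>r \<otimes> v\<^sub>s\<close> with those of \<open>v\<^sub>r \<otimes> w\<^sub>s\<close> injectively, so that
  Cauchy--Schwarz bounds the contribution of \<open>(r, s)\<close> by \<open>|w\<^sub>r| |w\<^sub>s|\<close>.
\<close>

unbundle no vec_syntax
unbundle no inner_syntax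

section \<open>Unitary triangularization and the nuclear norm\<close>

lemma mat_adjoint_dims [simp]:
  "dim_row (mat_adjoint A) = dim_col A" "dim_col (mat_adjoint A) = dim_row A"
  by (simp_all add: mat_adjoint_def)

lemma mat_adjoint_index:
  assumes "i < dim_col A" "j < dim_row A"
  shows "mat_adjoint A $$ (i, j) = conjugate (A $$ (j, i))"
  using assms by (simp add: mat_adjoint_def mat_of_rows_index)

lemma mat_adjoint_carrier [simp]:
  "A \<in> carrier_mat m n \<Longrightarrow> mat_adjoint A \<in> carrier_mat n m"
  by (auto intro: carrier_matI)

lemma mat_adjoint_mult:
  fixes A B :: "complex mat"
  assumes "A \<in> carrier_mat m n" "B \<in> carrier_mat n k"
  shows "mat_adjoint (A * B) = mat_adjoint B * mat_adjoint A"
  using assms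
  by (intro eq_matI) (auto simp: mat_adjoint_index scalar_prod_def mult.commute)

lemma mat_adjoint_block_diag:
  fixes P :: "complex mat"
  assumes "P \<in> carrier_mat n n"
  shows "mat_adjoint (four_block_mat (1\<^sub>m 1) (0\<^sub>m 1 n) (0\<^sub>m n 1) P) =
    four_block_mat (1\<^sub>m 1) (0\<^sub>m 1 n) (0\<^sub>m n 1) (mat_adjoint P)"
  using assms
  by (intro eq_matI) (auto simp: mat_adjoint_index four_block_mat_def Let_def)

text \<open>
  Gram--Schmidt gives an orthogonal basis that starts with \<open>v\<close>. Its vectors still have to be divided
  by their norms, because a product of matrices with merely orthogonal columns need not have
  orthogonal columns, and the triangularization below multiplies such matrices.
\<close>

lemma unitary_completion:
  fixes v :: "complex Matrix.vec"
  assumes v: "v \<in> carrier_vec n" and v0: "v \<noteq> 0\<^sub>v n"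
  obtains W c where "W \<in> carrier_mat n n" "mat_adjoint W * W = 1\<^sub>m n" "col W 0 = c \<cdot>\<^sub>v v"
proof -
  interpret cof_vec_space n "TYPE(complex)" .
  define ws where "ws = gram_schmidt n (basis_completion v)"
  note bc = basis_completion[OF v v0]
  have n: "n > 0"
    using v v0 by (cases n) auto
  obtain vs where bv: "basis_completion v = v # vs"
    using bc(6,7) n by (cases "basis_completion v") auto
  have ws: "set ws \<subseteq> carrier_vec n" "corthogonal ws" "length ws = n"
    using gram_schmidt_result[OF bc(2,4,5) refl, folded ws_def] bc(6) by auto
  have ws0: "ws ! 0 = v"
    using gram_schmidt_hd[OF v, of vs, folded bv] ws n
    by (metis hd_conv_nth list.size(3) less_irrefl ws_def)
  have wsc: "ws ! j \<in> carrier_vec n" if "j < n" for j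
    using ws that by auto
  define N where "N j = (\<Sum>i<n. (cmod (ws ! j $ i))\<^sup>2)" for j
  have inner: "ws ! j \<bullet>c ws ! k = (\<Sum>i<n. ws ! j $ i * cnj (ws ! k $ i))" if "j < n" "k < n" for j k
    using wsc[OF that(1)] wsc[OF that(2)] by (simp add: scalar_prod_def lessThan_atLeast0)
  have self: "ws ! j \<bullet>c ws ! j = complex_of_real (N j)" if "j < n" for j
    using that by (simp add: inner N_def flip: complex_norm_square)
  have Npos: "N j > 0" if "j < n" for j
  proof -
    have "ws ! j \<bullet>c ws ! j \<noteq> 0"
      using corthogonalD[OF ws(2), of j j] ws(3) that by auto
    then have "N j \<noteq> 0"
      using self that by auto
    moreover have "N j \<ge> 0" by (auto simp: N_def intro!: sum_nonneg)
    ultimately show ?thesis by simp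
  qed
  define W where "W = Matrix.mat n n (\<lambda>(i, j). ws ! j $ i / complex_of_real (sqrt (N j)))"
  have W: "W \<in> carrier_mat n n" by (simp add: W_def)
  have "mat_adjoint W * W = 1\<^sub>m n"
  proof (rule eq_matI)
    fix i j assume "i < dim_row (1\<^sub>m n :: complex mat)" "j < dim_col (1\<^sub>m n :: complex mat)"
    then have ij: "i < n" "j < n" by auto
    have "(mat_adjoint W * W) $$ (i, j) =
        (\<Sum>k<n. cnj (ws ! i $ k) * ws ! j $ k / (complex_of_real (sqrt (N i)) * complex_of_real (sqrt (N j))))"
      using ij W by (simp add: scalar_prod_def mat_adjoint_index W_def lessThan_atLeast0)
    also have "\<dots> = (ws ! j \<bullet>c ws ! i) / (complex_of_real (sqrt (N i)) * complex_of_real (sqrt (N j)))"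
      using ij by (simp add: inner sum_divide_distrib mult.commute)
    also have "\<dots> = (1\<^sub>m n) $$ (i, j)"
    proof (cases "i = j")
      case True
      have "complex_of_real (sqrt (N i)) * complex_of_real (sqrt (N i)) = of_real (N i)"
        using Npos[OF ij(1)] by (simp flip: of_real_mult)
      then show ?thesis using True ij self Npos[OF ij(1)] by simp
    next
      case False
      then show ?thesis
        using corthogonalD[OF ws(2), of j i] ws(3) ij by simp
    qed
    finally show "(mat_adjoint W * W) $$ (i, j) = (1\<^sub>m n) $$ (i, j)" .
  qed (use W in auto)
  moreover have "col W 0 = (1 / complex_of_real (sqrt (N 0))) \<cdot>\<^sub>v v"
    using n v by (intro eq_vecI) (auto simp: W_def ws0)
  ultimately show ?thesis using that W by blast
qed

text \<open>
  Schur's theorem with a unitary transformation. A unitary matrix whose first column is an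
  eigenvector of \<open>H\<close> brings the first column of \<open>H\<close> into triangular form; the induction hypothesis
  treats the remaining block. Orthonormality of the columns is what turns the diagonal entries for
  \<open>H = A\<^sup>* A\<close> into squared norms in \<open>rank_one_decomposition\<close>.
\<close>

lemma unitary_triangularization:
  fixes H :: "complex mat"
  assumes "H \<in> carrier_mat n n"
  shows "\<exists>U\<in>carrier_mat n n. mat_adjoint U * U = 1\<^sub>m n \<and> upper_triangular (mat_adjoint U * H * U)"
  using assms
proof (induction n arbitrary: H)
  case 0
  then show ?case
    by (intro bexI[of _ "1\<^sub>m 0"] conjI eq_matI) (auto simp: upper_triangular_def)
next
  case (Suc n)
  let ?N = "Suc n"
  have H: "H \<in> carrier_mat ?N ?N" by fact
  obtain as where as: "char_poly H = (\<Prod>a\<leftarrow>as. [:- a, 1:])" "length as = ?N"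
    using char_poly_factorized[OF H] by auto
  then have "poly (char_poly H) (hd as) = 0"
    by (cases as) auto
  then have "eigenvalue H (hd as)"
    by (simp add: eigenvalue_root_char_poly[OF H])
  then obtain v where v: "v \<in> carrier_vec ?N" "v \<noteq> 0\<^sub>v ?N" "H *\<^sub>v v = hd as \<cdot>\<^sub>v v"
    using H by (auto simp: eigenvalue_def eigenvector_def)
  obtain W c where W: "W \<in> carrier_mat ?N ?N" "mat_adjoint W * W = 1\<^sub>m ?N" "col W 0 = c \<cdot>\<^sub>v v"
    using unitary_completion[OF v(1,2)] by blast
  let ?W' = "mat_adjoint W"
  have W': "?W' \<in> carrier_mat ?N ?N" using W by simp
  define T where "T = ?W' * H * W"
  have T: "T \<in> carrier_mat ?N ?N" using mult_carrier_mat[OF mult_carrier_mat[OF W' H] W(1)] by (simp add: T_def)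
  have eig: "H *\<^sub>v col W 0 = hd as \<cdot>\<^sub>v col W 0"
    unfolding W(3) using v H by (simp add: mult_mat_vec smult_smult_assoc mult.commute)
  (* The first column of W is an eigenvector and is orthogonal to the other columns. *)
  have T0: "T $$ (i, 0) = 0" if "0 < i" "i < ?N" for i
  proof -
    have "T = ?W' * (H * W)"
      unfolding T_def using W' H W by (intro assoc_mult_mat) auto
    then have "T $$ (i, 0) = row ?W' i \<bullet> col (H * W) 0"
      using that W(1) H by simp
    also have "col (H * W) 0 = H *\<^sub>v col W 0"
      using col_mult2[OF H W(1)] by simp
    also have "row ?W' i \<bullet> (H *\<^sub>v col W 0) = hd as * (row ?W' i \<bullet> col W 0)"
      unfolding eig using row_carrier_vec[OF that(2) W'] col_carrier_vec[OF zero_less_Suc W(1)]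
      by (rule scalar_prod_smult_distrib)
    also have "row ?W' i \<bullet> col W 0 = (?W' * W) $$ (i, 0)"
      using that W(1) by simp
    also have "\<dots> = 0" using that by (simp add: W(2))
    finally show ?thesis by simp
  qed
  define T1 T2 T3 where "T1 = Matrix.mat 1 1 (\<lambda>_. T $$ (0, 0))"
    and "T2 = Matrix.mat 1 n (\<lambda>(_, j). T $$ (0, Suc j))"
    and "T3 = Matrix.mat n n (\<lambda>(i, j). T $$ (Suc i, Suc j))"
  have T123: "T1 \<in> carrier_mat 1 1" "T2 \<in> carrier_mat 1 n" "T3 \<in> carrier_mat n n"
    by (auto simp: T1_def T2_def T3_def)
  have Tblock: "T = four_block_mat T1 T2 (0\<^sub>m n 1) T3"
    using T by (intro eq_matI) (auto simp: T1_def T2_def T3_def four_block_mat_def Let_def T0)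
  obtain P where P: "P \<in> carrier_mat n n" "mat_adjoint P * P = 1\<^sub>m n"
      "upper_triangular (mat_adjoint P * T3 * P)"
    using Suc.IH[OF T123(3)] by blast
  let ?P' = "mat_adjoint P"
  have P': "?P' \<in> carrier_mat n n" using P by simp
  (* The transformation of the lower right block, extended by the identity. *)
  define F F' where "F = four_block_mat (1\<^sub>m 1) (0\<^sub>m 1 n) (0\<^sub>m n 1) P"
    and "F' = four_block_mat (1\<^sub>m 1) (0\<^sub>m 1 n) (0\<^sub>m n 1) ?P'"
  have F: "F \<in> carrier_mat ?N ?N" "F' \<in> carrier_mat ?N ?N" "mat_adjoint F = F'"
    using P P' mat_adjoint_block_diag[OF P(1)]
    by (auto simp: F_def F'_def)
  have z: "0\<^sub>m 1 n \<in> carrier_mat 1 n" "0\<^sub>m n 1 \<in> carrier_mat n 1" "1\<^sub>m 1 \<in> carrier_mat 1 1" by auto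
  have F'F: "F' * F = 1\<^sub>m ?N"
  proof -
    have "F' * F = four_block_mat (1\<^sub>m 1) (0\<^sub>m 1 n) (0\<^sub>m n 1) (1\<^sub>m n)"
      unfolding F_def F'_def
      by (subst mult_four_block_mat[OF z(3,1,2) P' z(3,1,2) P(1)]) (use P P' in simp)
    then show ?thesis by simp
  qed
  have F'TF: "F' * T * F = four_block_mat T1 (T2 * P) (0\<^sub>m n 1) (?P' * T3 * P)"
  proof -
    have "F' * T = four_block_mat T1 T2 (0\<^sub>m n 1) (?P' * T3)"
      unfolding F'_def Tblock
      by (subst mult_four_block_mat[OF z(3,1,2) P' T123(1,2) z(2) T123(3)])
         (use P' T123 right_mult_zero_mat[OF P', of 1] in simp)
    moreover have "?P' * T3 \<in> carrier_mat n n" using P' T123 by simp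
    ultimately show ?thesis
      unfolding F_def
      by (simp only:, subst mult_four_block_mat[OF T123(1,2) z(2) _ z(3,1,2) P(1)])
         (use P(1) P' T123 in auto)
  qed
  define U where "U = W * F"
  have U: "U \<in> carrier_mat ?N ?N" using W F by (simp add: U_def)
  have U': "mat_adjoint U = F' * ?W'"
    unfolding U_def using mat_adjoint_mult[OF W(1) F(1)] F(3) by simp
  have "mat_adjoint U * U = F' * (?W' * W) * F"
    unfolding U' unfolding U_def using W(1) W' F(1,2)
    by (simp add: assoc_mult_mat[of _ ?N ?N _ ?N _ ?N] mult_carrier_mat[of _ ?N ?N _ ?N])
  then have "mat_adjoint U * U = 1\<^sub>m ?N"
    using W(2) F F'F by simp
  moreover have "mat_adjoint U * H * U = F' * T * F"
    unfolding U' unfolding U_def T_def using W(1) W' F(1,2) H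
    by (simp add: assoc_mult_mat[of _ ?N ?N _ ?N _ ?N] mult_carrier_mat[of _ ?N ?N _ ?N])
  moreover have "upper_triangular (F' * T * F)"
    unfolding F'TF
  proof (rule upper_triangular_four_block[OF T123(1) _ _ P(3)])
    show "mat_adjoint P * T3 * P \<in> carrier_mat n n"
      using P' T123(3) P(1) by (intro mult_carrier_mat)
  qed (simp add: T1_def upper_triangular_def)
  ultimately show ?case using U by auto
qed

lemma gram_diagonal:
  fixes C :: "complex mat"
  assumes "C \<in> carrier_mat m n" "r < n"
  shows "(mat_adjoint C * C) $$ (r, r) = complex_of_real (\<Sum>a<m. (cmod (C $$ (a, r)))\<^sup>2)"
  using assms
  by (simp add: scalar_prod_def mat_adjoint_index lessThan_atLeast0 mult.commute flip: complex_norm_square)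

lemma proots_linear_factors:
  fixes as :: "complex list"
  shows "proots (\<Prod>a\<leftarrow>as. [:- a, 1:]) = mset as"
proof (induction as)
  case (Cons a as)
  have "(\<Prod>a\<leftarrow>as. [:- a, 1:]) \<noteq> 0"
    by (auto simp: prod_list_zero_iff)
  then have "proots ([:- a, 1:] * (\<Prod>a\<leftarrow>as. [:- a, 1:])) =
      proots [:- a, 1:] + proots (\<Prod>a\<leftarrow>as. [:- a, 1:])"
    by (intro proots_mult) auto
  then show ?case using Cons by (simp del: mult_pCons_left)
qed simp

text \<open>
  A weak form of the singular value decomposition: the vectors \<open>w r\<close> need not be orthogonal. Let
  \<open>U\<close> be unitary with \<open>U\<^sup>* A\<^sup>* A U\<close> upper triangular, and let \<open>v r\<close> be the columns of \<open>U\<close> and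
  \<open>w r = A (v r)\<close>. Then \<open>A = (A U) U\<^sup>*\<close> is the sum of the \<open>w r (v r)\<^sup>*\<close>, and
  \<open>|w r|\<^sup>2\<close> is the \<open>r\<close>-th diagonal entry of \<open>U\<^sup>* A\<^sup>* A U\<close>. The diagonal of a triangular matrix lists
  the eigenvalues, so the \<open>|w r|\<close> are the singular values.
\<close>

lemma rank_one_decomposition:
  fixes A :: "complex mat"
  assumes A: "A \<in> carrier_mat n n"
  obtains w v :: "nat \<Rightarrow> nat \<Rightarrow> complex" where
    "\<And>a b. a < n \<Longrightarrow> b < n \<Longrightarrow> A $$ (a, b) = (\<Sum>r<n. w r a * cnj (v r b))"
    "\<And>r. r < n \<Longrightarrow> (\<Sum>a<n. (cmod (v r a))\<^sup>2) = 1"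
    "(\<Sum>r<n. sqrt (\<Sum>a<n. (cmod (w r a))\<^sup>2)) = nuclear_norm A"
proof -
  define H where "H = mat_adjoint A * A"
  have A': "mat_adjoint A \<in> carrier_mat n n" using A by simp
  have H: "H \<in> carrier_mat n n" using mult_carrier_mat[OF A' A] by (simp add: H_def)
  obtain U where U: "U \<in> carrier_mat n n" "mat_adjoint U * U = 1\<^sub>m n"
      "upper_triangular (mat_adjoint U * H * U)"
    using unitary_triangularization[OF H] by blast
  define B where "B = mat_adjoint U * H * U"
  have U': "mat_adjoint U \<in> carrier_mat n n" using U by simp
  have B: "B \<in> carrier_mat n n"
    using mult_carrier_mat[OF mult_carrier_mat[OF U' H] U(1)] by (simp add: B_def)
  have UU': "U * mat_adjoint U = 1\<^sub>m n"
    using mat_mult_left_right_inverse[OF U' U(1) U(2)] .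
  have AU: "A * U \<in> carrier_mat n n" using A U by simp
  have "A = A * (U * mat_adjoint U)" using A by (simp add: UU')
  also have "\<dots> = A * U * mat_adjoint U" using A U U' by (simp add: assoc_mult_mat[of _ n n _ n _ n] mult_carrier_mat[of _ n n _ n])
  finally have dec: "A = A * U * mat_adjoint U" .
  have 1: "A $$ (a, b) = (\<Sum>r<n. (A * U) $$ (a, r) * cnj (U $$ (b, r)))" if "a < n" "b < n" for a b
  proof -
    have "A $$ (a, b) = (A * U * mat_adjoint U) $$ (a, b)" using dec by simp
    also have "\<dots> = row (A * U) a \<bullet> col (mat_adjoint U) b"
      using U(1) A that by (intro index_mult_mat) auto
    also have "\<dots> = (\<Sum>r<n. (A * U) $$ (a, r) * cnj (U $$ (b, r)))"
      unfolding scalar_prod_def lessThan_atLeast0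
      using U(1) that A by (intro sum.cong) (auto simp: mat_adjoint_index)
    finally show ?thesis .
  qed
  have 2: "(\<Sum>a<n. (cmod (U $$ (a, r)))\<^sup>2) = 1" if "r < n" for r
  proof -
    have "complex_of_real (\<Sum>a<n. (cmod (U $$ (a, r)))\<^sup>2) = 1"
      unfolding gram_diagonal[OF U(1) that, symmetric] U(2) using that by simp
    then show ?thesis using of_real_eq_1_iff by blast
  qed
  have BAU: "B = mat_adjoint (A * U) * (A * U)"
    unfolding B_def H_def mat_adjoint_mult[OF A U(1)]
    using A A' U U' by (simp add: assoc_mult_mat[of _ n n _ n _ n] mult_carrier_mat[of _ n n _ n])
  have Bd: "sqrt (\<Sum>a<n. (cmod ((A * U) $$ (a, r)))\<^sup>2) = sqrt (Re (B $$ (r, r)))" if "r < n" for r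
    unfolding BAU gram_diagonal[OF AU that] by simp
  have "similar_mat_wit B H (mat_adjoint U) U"
    using U U' UU' H B by (intro similar_mat_witI[of _ _ n]) (auto simp: B_def)
  then have "char_poly H = char_poly B"
    using char_poly_similar unfolding similar_mat_def by metis
  also have "\<dots> = (\<Prod>a\<leftarrow>diag_mat B. [:- a, 1:])"
    using char_poly_upper_triangular[OF B] U(3) by (simp add: B_def)
  finally have "proots (char_poly H) = mset (diag_mat B)"
    by (simp add: proots_linear_factors)
  then have "nuclear_norm A = (\<Sum>z\<leftarrow>diag_mat B. sqrt (Re z))"
    by (simp add: nuclear_norm_def singular_values_def H_def flip: sum_mset_sum_list)
  also have "\<dots> = (\<Sum>r<n. sqrt (Re (B $$ (r, r))))"
    using B by (simp add: diag_mat_def interv_sum_list_conv_sum_set_nat lessThan_atLeast0 comp_def)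
  finally have 3: "(\<Sum>r<n. sqrt (\<Sum>a<n. (cmod ((A * U) $$ (a, r)))\<^sup>2)) = nuclear_norm A"
    using Bd by simp
  show ?thesis
    by (rule that[of "\<lambda>r a. (A * U) $$ (a, r)" "\<lambda>r a. U $$ (a, r)"]) (fact 1 2 3)+
qed

section \<open>Mixed moments of independent complex Gaussians\<close>

text \<open>
  The \<open>k\<close>-th moment of a centred real normal variable of variance \<open>s\<close>.
\<close>

definition normal_moment :: "real \<Rightarrow> nat \<Rightarrow> real" where
  "normal_moment s k = (if even k then fact k / ((2 / s) ^ (k div 2) * fact (k div 2)) else 0)"

lemma has_bochner_integral_normal_power:
  assumes "s > 0"
  shows "has_bochner_integral (density lborel (\<lambda>u. ennreal (normal_density 0 (sqrt s) u)))
    (\<lambda>u. u ^ k) (normal_moment s k)"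
proof (rule has_bochner_integral_density)
  show "has_bochner_integral lborel (\<lambda>u. normal_density 0 (sqrt s) u *\<^sub>R u ^ k) (normal_moment s k)"
  proof (cases "even k")
    case True
    then obtain l where "k = 2 * l" by blast
    then show ?thesis
      using normal_moment_even[of "sqrt s" 0 l] assms by (simp add: normal_moment_def)
  next
    case False
    then obtain l where "k = 2 * l + 1" using oddE by blast
    then show ?thesis
      using normal_moment_odd[of "sqrt s" 0 l] assms by (simp add: normal_moment_def)
  qed
qed (auto simp: normal_density_nonneg)

lemma (in pair_sigma_finite) has_bochner_integral_pair_mult:
  fixes f :: "'a \<Rightarrow> real" and g :: "'b \<Rightarrow> real"
  assumes f: "has_bochner_integral M1 f a" and g: "has_bochner_integral M2 g b"
  shows "has_bochner_integral (M1 \<Otimes>\<^sub>M M2) (\<lambda>(x, y). f x * g y) (a * b)"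
proof -
  have [measurable]: "f \<in> borel_measurable M1" "g \<in> borel_measurable M2"
    using f g by (auto intro: borel_measurable_has_bochner_integral)
  have i: "integrable M1 f" "integrable M2 g"
    using f g by (auto intro: integrable.intros)
  have int: "integrable (M1 \<Otimes>\<^sub>M M2) (\<lambda>(x, y). f x * g y)"
    by (rule Fubini_integrable) (use i in \<open>auto simp: abs_mult\<close>)
  moreover have "integral\<^sup>L (M1 \<Otimes>\<^sub>M M2) (\<lambda>(x, y). f x * g y) = a * b"
    using integral_fst[of "\<lambda>x y. f x * g y"] int f g
    by (simp add: has_bochner_integral_integral_eq)
  ultimately show ?thesis by (simp add: has_bochner_integral_iff)
qed

lemma borel_measurable_cnj [measurable]: "cnj \<in> borel_measurable borel"
  by (intro borel_measurable_continuous_onI continuous_intros)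

text \<open>
  The binomial theorem reduces the moment to products of moments of the real and the imaginary
  part, which have variance \<open>v / 2\<close> each. Up to total degree four, which is all that is needed for
  fourth moments, the resulting sums can be evaluated one by one.
\<close>

lemma complex_normal_moment:
  assumes v: "v > 0" and m: "m + m' \<le> 4"
  shows "has_bochner_integral (complex_normal v) (\<lambda>z. z ^ m * cnj z ^ m')
    (if m = m' then fact m * complex_of_real v ^ m else 0)"
proof -
  define s where "s = v / 2"
  have s: "s > 0" using v by (simp add: s_def)
  define N where "N = density lborel (\<lambda>u. ennreal (normal_density 0 (sqrt s) u))"
  interpret N: prob_space N
    unfolding N_def using s by (intro prob_space_normal_density) auto
  interpret NN: pair_sigma_finite N N ..
  have [measurable_cong]: "sets N = sets borel" by (simp add: N_def)
  let ?Z = "\<lambda>(u, w). complex_of_real u + \<i> * complex_of_real w"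
  let ?c = "\<lambda>k l. of_nat (m choose k) * of_nat (m' choose l) * \<i> ^ (m - k) * cnj \<i> ^ (m' - l) :: complex"
  have P: "has_bochner_integral (N \<Otimes>\<^sub>M N) (\<lambda>(u, w). complex_of_real (u ^ a * u ^ a' * (w ^ b * w ^ b')))
      (of_real (normal_moment s (a + a') * normal_moment s (b + b')))" for a a' b b'
    using has_bochner_integral_of_real[OF NN.has_bochner_integral_pair_mult[OF
      has_bochner_integral_normal_power[OF s, of "a + a'", folded N_def]
      has_bochner_integral_normal_power[OF s, of "b + b'", folded N_def]], where 'a=complex]
    by (simp add: case_prod_unfold power_add)
  have "has_bochner_integral (N \<Otimes>\<^sub>M N)
      (\<lambda>x. \<Sum>k\<le>m. \<Sum>l\<le>m'. ?c k l *
        (case x of (u, w) \<Rightarrow> complex_of_real (u ^ k * u ^ l * (w ^ (m - k) * w ^ (m' - l)))))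
      (\<Sum>k\<le>m. \<Sum>l\<le>m'. ?c k l *
        of_real (normal_moment s (k + l) * normal_moment s ((m - k) + (m' - l))))"
    by (intro has_bochner_integral_sum has_bochner_integral_mult_right P)
  also have "(\<lambda>x. \<Sum>k\<le>m. \<Sum>l\<le>m'. ?c k l *
        (case x of (u, w) \<Rightarrow> complex_of_real (u ^ k * u ^ l * (w ^ (m - k) * w ^ (m' - l))))) =
      (\<lambda>x. ?Z x ^ m * cnj (?Z x) ^ m')"
  proof
    fix x :: "real \<times> real"
    obtain u w where x: "x = (u, w)" by force
    show "(\<Sum>k\<le>m. \<Sum>l\<le>m'. ?c k l *
        (case x of (u, w) \<Rightarrow> complex_of_real (u ^ k * u ^ l * (w ^ (m - k) * w ^ (m' - l))))) =
        ?Z x ^ m * cnj (?Z x) ^ m'"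
      unfolding x split_conv complex_cnj_add complex_cnj_mult complex_cnj_complex_of_real
        binomial_ring sum_product
      by (intro sum.cong refl) (simp add: power_mult_distrib del: complex_cnj_i)
  qed
  (* Fifteen cases with explicit sums; successor notation lets the simplifier unfold them. *)
  also have "(\<Sum>k\<le>m. \<Sum>l\<le>m'. ?c k l *
        of_real (normal_moment s (k + l) * normal_moment s ((m - k) + (m' - l)))) =
      (if m = m' then fact m * complex_of_real v ^ m else 0)"
  proof -
    have "normal_moment s 0 = 1" "normal_moment s 1 = 0" "normal_moment s 2 = s"
      "normal_moment s 3 = 0" "normal_moment s 4 = 3 * s\<^sup>2"
      using s by (auto simp: normal_moment_def fact_numeral power2_eq_square field_simps)
    then have nm: "normal_moment s 0 = 1" "normal_moment s (Suc 0) = 0" "normal_moment s (Suc (Suc 0)) = s"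
      "normal_moment s (Suc (Suc (Suc 0))) = 0" "normal_moment s (Suc (Suc (Suc (Suc 0)))) = 3 * s\<^sup>2"
      by (simp_all add: eval_nat_numeral)
    have v2: "complex_of_real v = 2 * complex_of_real s"
      by (simp add: s_def)
    have "m = 0 \<or> m = Suc 0 \<or> m = Suc (Suc 0) \<or> m = Suc (Suc (Suc 0)) \<or> m = Suc (Suc (Suc (Suc 0)))"
      "m' = 0 \<or> m' = Suc 0 \<or> m' = Suc (Suc 0) \<or> m' = Suc (Suc (Suc 0)) \<or> m' = Suc (Suc (Suc (Suc 0)))"
      using m by auto
    then show ?thesis
      using m
      by (elim disjE; simp only:)
         (simp_all add: nm v2 power2_eq_square)
  qed
  finally have "has_bochner_integral (N \<Otimes>\<^sub>M N) (\<lambda>x. ?Z x ^ m * cnj (?Z x) ^ m')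
      (if m = m' then fact m * complex_of_real v ^ m else 0)" .
  moreover have "complex_normal v = distr (N \<Otimes>\<^sub>M N) borel ?Z"
    by (simp add: complex_normal_def N_def s_def Let_def)
  moreover have "?Z \<in> measurable (N \<Otimes>\<^sub>M N) borel" by measurable
  moreover have "(\<lambda>z. z ^ m * cnj z ^ m') \<in> borel_measurable borel" by measurable
  ultimately show ?thesis
    by (auto simp add: has_bochner_integral_iff integrable_distr_eq integral_distr simp del: power_Suc)
qed

lemma indep_complex_normals_monomial:
  assumes Z: "indep_complex_normals M Z v K" and K: "finite K"
    and v: "\<And>k. k \<in> K \<Longrightarrow> v k > 0" and m: "\<And>k. k \<in> K \<Longrightarrow> m k + m' k \<le> 4"
  shows "has_bochner_integral M (\<lambda>x. \<Prod>k\<in>K. Z k x ^ m k * cnj (Z k x) ^ m' k)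
    (\<Prod>k\<in>K. if m k = m' k then fact (m k) * complex_of_real (v k) ^ m k else 0)"
proof -
  interpret prob_space M using Z by (simp add: indep_complex_normals_def)
  let ?f = "\<lambda>k z. z ^ m k * cnj z ^ m' k :: complex"
  have ind: "indep_vars (\<lambda>_. borel) Z K" and law: "\<And>k. k \<in> K \<Longrightarrow> distr M borel (Z k) = complex_normal (v k)"
    using Z by (auto simp: indep_complex_normals_def)
  have meas: "Z k \<in> borel_measurable M" if "k \<in> K" for k
    using ind that by (auto simp: indep_vars_def)
  have mom: "has_bochner_integral M (\<lambda>x. ?f k (Z k x))
      (if m k = m' k then fact (m k) * complex_of_real (v k) ^ m k else 0)" if k: "k \<in> K" for k
  proof -
    have [measurable]: "?f k \<in> borel_measurable borel" by measurable
    show ?thesis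
      using complex_normal_moment[OF v[OF k] m[OF k]] meas[OF k]
      by (simp only: law[OF k, symmetric] has_bochner_integral_iff integrable_distr_eq integral_distr
        \<open>?f k \<in> borel_measurable borel\<close>)
  qed
  have "indep_vars (\<lambda>_. borel) (\<lambda>k x. ?f k (Z k x)) K"
    by (intro indep_vars_compose2[OF ind]) measurable
  from indep_vars_integrable[OF K this] indep_vars_lebesgue_integral[OF K this]
  show ?thesis
    using mom by (simp add: has_bochner_integral_iff cong: prod.cong)
qed

text \<open>
  The mixed moment of independent variables \<open>Z\<^sub>r\<close>, \<open>r \<in> R\<close>, with law \<open>N\<^sub>C(0, v)\<close>, in which \<open>xs\<close>
  lists the plain and \<open>ys\<close> the conjugated factors with their multiplicities. It is zero
  unless the two lists agree up to order, in which case \<open>r\<close> contributes \<open>m! v\<^sup>m\<close>, where \<open>m\<close> is its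
  multiplicity.
\<close>

definition wick_moment :: "real \<Rightarrow> 'r set \<Rightarrow> 'r list \<Rightarrow> 'r list \<Rightarrow> complex" where
  "wick_moment v R xs ys = (\<Prod>r\<in>R.
     if count_list xs r = count_list ys r
     then fact (count_list xs r) * complex_of_real v ^ count_list xs r else 0)"

lemma prod_power_count_list:
  fixes f :: "'r \<Rightarrow> 'b::comm_monoid_mult"
  assumes "finite R" "set xs \<subseteq> R"
  shows "(\<Prod>r\<in>R. f r ^ count_list xs r) = (\<Prod>r\<leftarrow>xs. f r)"
  using assms(2)
proof (induction xs)
  case (Cons x xs)
  have "(\<Prod>r\<in>R. f r ^ count_list (x # xs) r) =
      (\<Prod>r\<in>R. (if r = x then f x else 1) * f r ^ count_list xs r)"
    by (intro prod.cong) auto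
  also have "\<dots> = f x * (\<Prod>r\<leftarrow>xs. f r)"
    using Cons assms(1) by (simp add: prod.distrib)
  finally show ?case by simp
qed simp

text \<open>
  Both random vectors are built from independent Gaussians that are indexed by a block (the core, or
  the part of the composition) and a position inside the block, and a product of their entries has
  the same number of factors in each block. Its expectation then factorises over the blocks.
\<close>

lemma blockwise_moment:
  fixes Z :: "'p \<times> 'r \<Rightarrow> 'x \<Rightarrow> complex"
  assumes Z: "indep_complex_normals M Z v (Sigma P R)"
    and P: "finite P" and R: "\<And>p. p \<in> P \<Longrightarrow> finite (R p)"
    and v: "\<And>p r. p \<in> P \<Longrightarrow> r \<in> R p \<Longrightarrow> v (p, r) = \<sigma> p" "\<And>p. p \<in> P \<Longrightarrow> \<sigma> p > 0"
    and xs: "\<And>p. p \<in> P \<Longrightarrow> set (xs p) \<subseteq> R p" "\<And>p. p \<in> P \<Longrightarrow> set (ys p) \<subseteq> R p"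
      "\<And>p. p \<in> P \<Longrightarrow> length (xs p) + length (ys p) \<le> 4"
  shows "has_bochner_integral M
    (\<lambda>x. \<Prod>p\<in>P. (\<Prod>r\<leftarrow>xs p. Z (p, r) x) * cnj (\<Prod>r\<leftarrow>ys p. Z (p, r) x))
    (\<Prod>p\<in>P. wick_moment (\<sigma> p) (R p) (xs p) (ys p))"
proof -
  let ?m = "\<lambda>(p, r). count_list (xs p) r" and ?m' = "\<lambda>(p, r). count_list (ys p) r"
  have le: "?m k + ?m' k \<le> 4" if "k \<in> Sigma P R" for k
    using that xs(3)[of "fst k"] count_le_length[of "xs (fst k)" "snd k"]
      count_le_length[of "ys (fst k)" "snd k"] by (auto split: prod.splits)
  have "has_bochner_integral M (\<lambda>x. \<Prod>k\<in>Sigma P R. Z k x ^ ?m k * cnj (Z k x) ^ ?m' k)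
    (\<Prod>k\<in>Sigma P R. if ?m k = ?m' k then fact (?m k) * complex_of_real (v k) ^ ?m k else 0)"
    using v by (intro indep_complex_normals_monomial[OF Z] finite_SigmaI P R le) auto
  also have "(\<lambda>x. \<Prod>k\<in>Sigma P R. Z k x ^ ?m k * cnj (Z k x) ^ ?m' k) =
      (\<lambda>x. \<Prod>p\<in>P. (\<Prod>r\<leftarrow>xs p. Z (p, r) x) * cnj (\<Prod>r\<leftarrow>ys p. Z (p, r) x))"
  proof
    fix x
    have "(\<Prod>k\<in>Sigma P R. Z k x ^ ?m k * cnj (Z k x) ^ ?m' k) =
        (\<Prod>p\<in>P. \<Prod>r\<in>R p. Z (p, r) x ^ count_list (xs p) r * cnj (Z (p, r) x ^ count_list (ys p) r))"
    proof (subst prod.Sigma)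
      show "(\<Prod>k\<in>Sigma P R. Z k x ^ ?m k * cnj (Z k x) ^ ?m' k) = (\<Prod>(p, r)\<in>Sigma P R.
          Z (p, r) x ^ count_list (xs p) r * cnj (Z (p, r) x ^ count_list (ys p) r))"
        by (rule prod.cong) auto
    qed (use P R in auto)
    also have "\<dots> = (\<Prod>p\<in>P. (\<Prod>r\<leftarrow>xs p. Z (p, r) x) * cnj (\<Prod>r\<leftarrow>ys p. Z (p, r) x))"
      using R xs by (intro prod.cong refl)
        (simp only: prod.distrib cnj_prod[symmetric] prod_power_count_list[of _ _ "\<lambda>r. Z (_, r) x"])
    finally show "(\<Prod>k\<in>Sigma P R. Z k x ^ ?m k * cnj (Z k x) ^ ?m' k) =
        (\<Prod>p\<in>P. (\<Prod>r\<leftarrow>xs p. Z (p, r) x) * cnj (\<Prod>r\<leftarrow>ys p. Z (p, r) x))" .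
  qed
  also have "(\<Prod>k\<in>Sigma P R. if ?m k = ?m' k then fact (?m k) * complex_of_real (v k) ^ ?m k else 0) =
      (\<Prod>p\<in>P. wick_moment (\<sigma> p) (R p) (xs p) (ys p))"
    using P R v(1) unfolding wick_moment_def by (subst prod.Sigma) (auto intro!: prod.cong)
  finally show ?thesis .
qed

text \<open>
  Variables without a factor contribute \<open>0! v\<^sup>0 = 1\<close>.
\<close>

lemma wick_moment_restrict:
  assumes "finite R" "set xs \<subseteq> R" "set ys \<subseteq> R"
  shows "wick_moment v R xs ys = wick_moment v (set xs \<union> set ys) xs ys"
  unfolding wick_moment_def using assms
  by (intro prod.mono_neutral_right) auto

lemma wick_moment_eq_0:
  assumes "finite R" "r \<in> R" "count_list xs r \<noteq> count_list ys r"
  shows "wick_moment v R xs ys = 0"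
  unfolding wick_moment_def using assms by (intro prod_zero bexI[of _ r]) simp_all

lemma wick_moment_1_1:
  assumes "finite R" "a \<in> R" "c \<in> R"
  shows "wick_moment v R [a] [c] = of_real v * of_bool (a = c)"
proof (cases "a = c")
  case True
  then show ?thesis
    using assms by (subst wick_moment_restrict) (simp_all add: wick_moment_def)
next
  case False
  then have "wick_moment v R [a] [c] = 0"
    using assms by (intro wick_moment_eq_0[of _ a]) simp_all
  then show ?thesis using False by simp
qed

text \<open>
  The two ways \<open>a = 1, 2\<close> to match the plain factors \<open>i, j\<close> with the conjugated factors \<open>k, l\<close>. This is
  the Wick tensor for indices of any type: it is also needed for the index triples of the cores and
  for multi-indices.
\<close>

definition pairing :: "'r \<Rightarrow> 'r \<Rightarrow> 'r \<Rightarrow> 'r \<Rightarrow> nat \<Rightarrow> complex" where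
  "pairing i j k l a =
     (if a = 1 then of_bool (i = k) * of_bool (j = l) else of_bool (i = l) * of_bool (j = k))"

lemma sum_1_to_2: "(\<Sum>t=1..2. f t) = f 1 + f (2::nat)"
  for f :: "nat \<Rightarrow> 'a::comm_monoid_add"
  by (simp add: numeral_2_eq_2)

text \<open>
  Wick's formula. If \<open>a = b\<close>, both matchings hold at the same time; this is the factor
  \<open>E|Z|\<^sup>4 = 2 v\<^sup>2\<close>.
\<close>

lemma wick_moment_2_2:
  assumes "finite R" "a \<in> R" "b \<in> R" "c \<in> R" "d \<in> R"
  shows "wick_moment v R [a, b] [c, d] = of_real v ^ 2 * (\<Sum>t=1..2. pairing a b c d t)"
proof -
  have "(\<Sum>t=1..2. pairing a b c d t) = of_bool (a = c \<and> b = d) + of_bool (a = d \<and> b = c)"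
    unfolding sum_1_to_2 pairing_def by (simp only: if_True if_False of_bool_conj one_eq_numeral_iff refl num.distinct numeral_eq_one_iff)
  moreover have "wick_moment v R [a, b] [c, d] =
      of_real v ^ 2 * (of_bool (a = c \<and> b = d) + of_bool (a = d \<and> b = c))"
  proof (cases "(a = c \<and> b = d) \<or> (a = d \<and> b = c)")
    case True
    then have "count_list [c, d] r = count_list [a, b] r" for r by auto
    moreover have "set [c, d] = set [a, b]" using True by auto
    ultimately have "wick_moment v R [a, b] [c, d] =
        (\<Prod>r\<in>{a, b}. fact (count_list [a, b] r) * complex_of_real v ^ count_list [a, b] r)"
      using assms by (subst wick_moment_restrict) (simp_all add: wick_moment_def)
    also have "\<dots> = of_real v ^ 2 * (if a = b then 2 else 1)"
      by (simp add: power2_eq_square)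
    finally have W: "wick_moment v R [a, b] [c, d] = of_real v ^ 2 * (if a = b then 2 else 1)" .
    have "of_bool (a = c \<and> b = d) + of_bool (a = d \<and> b = c) = (if a = b then 2 else 1 :: complex)"
      using True by auto
    then show ?thesis using W by (simp only:)
  next
    case False
    then obtain r where "r \<in> R" "count_list [a, b] r \<noteq> count_list [c, d] r"
      using assms by (cases "a = c"; cases "a = d") fastforce+
    then have "wick_moment v R [a, b] [c, d] = 0"
      by (rule wick_moment_eq_0[OF assms(1)])
    moreover have "\<not> (a = c \<and> b = d)" "\<not> (a = d \<and> b = c)" using False by auto
    ultimately show ?thesis by (simp only: of_bool_eq(1) add_0_left mult_zero_right)
  qed
  ultimately show ?thesis by (simp only:)
qed

section \<open>Moments of the matrix product state\<close>

text \<open>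
  Equality of the index triples of a core splits into conditions on the left bond, the physical index
  and the right bond.
\<close>

lemma pairing_triple:
  "pairing (a, i, a') (b, j, b') (c, k, c') (e, l, e') t =
     pairing a b c e t * pairing i j k l t * pairing a' b' c' e' t"
  by (auto simp: pairing_def)

lemma wick_tensor_eq_pairing: "wick_tensor = pairing"
  by (intro ext) (simp add: wick_tensor_def pairing_def)

lemma prod_of_bool:
  fixes A :: "'a set"
  assumes "finite A"
  shows "(\<Prod>x\<in>A. of_bool (P x)) = (of_bool (\<forall>x\<in>A. P x) :: 'b::comm_semiring_1)"
  using assms by (induction A rule: finite_induct) auto

lemma sum_of_bool_eq_mult:
  fixes f :: "'a \<Rightarrow> 'b::semiring_1"
  assumes "finite S"
  shows "(\<Sum>e\<in>S. of_bool (a = e) * f e) = (if a \<in> S then f a else 0)"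
  using assms by (simp add: of_bool_def if_distrib[of "\<lambda>x. x * _"] cong: if_cong)

text \<open>
  This sum over the four bond indices at one position is where the transfer matrix comes from. Each of
  the matchings \<open>s, t\<close> of the adjacent cores identifies the indices in two pairs. Two equal
  matchings leave two free indices; two different ones identify all four.
\<close>

lemma fourfold_sum_pairing:
  fixes S :: "'a set"
  assumes S: "finite S" and st: "s \<in> {1, 2}" "t \<in> {1, 2}"
  shows "(\<Sum>a\<in>S. \<Sum>c\<in>S. \<Sum>b\<in>S. \<Sum>e\<in>S. pairing a b c e s * pairing a b c e t) =
    (if s = t then of_nat (card S) ^ 2 else of_nat (card S))"
proof -
  consider "s = 1" "t = 1" | "s = 2" "t = 2" | "s \<noteq> t" "s = 1 \<and> t = 2 \<or> s = 2 \<and> t = 1"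
    using st by auto
  then show ?thesis
  proof cases
    case 1
    then have "(\<Sum>a\<in>S. \<Sum>c\<in>S. \<Sum>b\<in>S. \<Sum>e\<in>S. pairing a b c e s * pairing a b c e t) =
        (\<Sum>a\<in>S. \<Sum>c\<in>S. \<Sum>b\<in>S. \<Sum>e\<in>S. of_bool (b = e) * of_bool (a = c))"
      by (intro sum.cong refl) (auto simp: pairing_def)
    also have "\<dots> = (\<Sum>a\<in>S. \<Sum>c\<in>S. of_bool (a = c) * of_nat (card S))"
      using S by (intro sum.cong refl) (simp add: sum_of_bool_eq_mult mult.commute cong: sum.cong)
    also have "\<dots> = of_nat (card S) ^ 2"
      using S by (simp add: sum_of_bool_eq_mult power2_eq_square cong: sum.cong)
    finally show ?thesis using 1 by simp
  next
    case 2
    then have "(\<Sum>a\<in>S. \<Sum>c\<in>S. \<Sum>b\<in>S. \<Sum>e\<in>S. pairing a b c e s * pairing a b c e t) =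
        (\<Sum>a\<in>S. \<Sum>c\<in>S. \<Sum>b\<in>S. \<Sum>e\<in>S. of_bool (a = e) * (of_bool (c = b) * 1))"
      by (intro sum.cong refl) (auto simp: pairing_def)
    also have "\<dots> = of_nat (card S) ^ 2"
      unfolding sum_of_bool_eq_mult[OF S]
      using S by (simp add: sum_of_bool_eq_mult[OF S] power2_eq_square del: mult_1_right cong: sum.cong)
    finally show ?thesis using 2 by simp
  next
    case 3
    then have "(\<Sum>a\<in>S. \<Sum>c\<in>S. \<Sum>b\<in>S. \<Sum>e\<in>S. pairing a b c e s * pairing a b c e t) =
        (\<Sum>a\<in>S. \<Sum>c\<in>S. \<Sum>b\<in>S. \<Sum>e\<in>S. of_bool (a = e) * (of_bool (a = b) * (of_bool (a = c) * 1)))"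
      by (intro sum.cong refl) (auto simp: pairing_def)
    also have "\<dots> = of_nat (card S)"
      using S by (simp add: sum_of_bool_eq_mult[OF S] del: mult_1_right cong: sum.cong)
    finally show ?thesis using 3 by simp
  qed
qed

text \<open>
  The outer bonds \<open>0\<close> and \<open>n\<close> carry the dummy index \<open>1\<close>, so that all cores, including those at the
  ends, have the same form.
\<close>

definition bond :: "nat \<Rightarrow> (nat \<Rightarrow> nat) \<Rightarrow> nat \<Rightarrow> nat" where
  "bond n \<alpha> p = (if p \<in> {1..n-1} then \<alpha> p else 1)"

abbreviation core_key :: "nat \<Rightarrow> (nat \<Rightarrow> nat) \<Rightarrow> (nat \<Rightarrow> nat) \<Rightarrow> nat \<Rightarrow> nat \<times> nat \<times> nat" where
  "core_key n i \<alpha> p \<equiv> (bond n \<alpha> (p - 1), i p, bond n \<alpha> p)"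

abbreviation bonds :: "nat \<Rightarrow> nat \<Rightarrow> (nat \<Rightarrow> nat) set" where
  "bonds chi n \<equiv> {1..n-1} \<rightarrow>\<^sub>E {1..chi}"

definition core_keys :: "nat \<Rightarrow> nat \<Rightarrow> nat \<Rightarrow> nat \<Rightarrow> (nat \<times> nat \<times> nat) set" where
  "core_keys d chi n p =
     (if p = 1 then {1} else {1..chi}) \<times> {1..d} \<times> (if p = n then {1} else {1..chi})"

lemma core_entries_eq_Sigma: "core_entries d chi n = Sigma {1..n} (core_keys d chi n)"
  by (auto simp: core_entries_def core_keys_def)

lemma finite_core_keys: "finite (core_keys d chi n p)"
  by (simp add: core_keys_def)

lemma core_key_in_core_keys:
  assumes "n \<ge> 2" "i \<in> multi_indices d n" "\<alpha> \<in> bonds chi n" "p \<in> {1..n}"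
  shows "core_key n i \<alpha> p \<in> core_keys d chi n p"
proof -
  have "i p \<in> {1..d}" using assms(2,4) by (auto simp: multi_indices_def)
  moreover have "bond n \<alpha> q \<in> {1..chi}" if "q \<in> {1..n-1}" for q
    using assms(3) that by (auto simp: bond_def PiE_iff)
  moreover have "bond n \<alpha> 0 = 1" "bond n \<alpha> n = 1"
    using assms(1) by (auto simp: bond_def)
  moreover have "p - 1 \<in> {1..n-1}" if "p \<noteq> 1" using that assms(4) by auto
  moreover have "p \<in> {1..n-1}" if "p \<noteq> n" using that assms(4) by auto
  ultimately show ?thesis by (auto simp: core_keys_def)
qed

text \<open>
  With the dummy outer bonds, an entry is a sum of products over all cores alike.
\<close>

lemma mps_eq_sum_prod:
  assumes "n \<ge> 2"
  shows "mps chi n G i x = (\<Sum>\<alpha>\<in>bonds chi n. \<Prod>p=1..n. G (p, core_key n i \<alpha> p) x)"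
  unfolding mps_def
proof (rule sum.cong[OF refl])
  fix \<alpha>
  have "{1..n} = insert 1 (insert n {2..n-1})" using assms by auto
  then have "(\<Prod>p=1..n. G (p, core_key n i \<alpha> p) x) =
      G (1, core_key n i \<alpha> 1) x * (G (n, core_key n i \<alpha> n) x * (\<Prod>p=2..n-1. G (p, core_key n i \<alpha> p) x))"
    using assms by simp
  also have "(\<Prod>p=2..n-1. G (p, core_key n i \<alpha> p) x) = (\<Prod>p=2..n-1. G (p, \<alpha> (p-1), i p, \<alpha> p) x)"
    using assms by (intro prod.cong) (auto simp: bond_def)
  finally have prod: "(\<Prod>p=1..n. G (p, core_key n i \<alpha> p) x) =
      G (1, core_key n i \<alpha> 1) x * (G (n, core_key n i \<alpha> n) x *
        (\<Prod>p=2..n-1. G (p, \<alpha> (p-1), i p, \<alpha> p) x))" .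
  show "G (1, 1, i 1, \<alpha> 1) x * (\<Prod>p=2..n-1. G (p, \<alpha> (p-1), i p, \<alpha> p) x) *
      G (n, \<alpha> (n-1), i n, 1) x = (\<Prod>p=1..n. G (p, core_key n i \<alpha> p) x)"
  proof -
    have "bond n \<alpha> 0 = 1" "bond n \<alpha> 1 = \<alpha> 1" "bond n \<alpha> (n - 1) = \<alpha> (n - 1)" "bond n \<alpha> n = 1"
      using assms by (auto simp: bond_def)
    then show ?thesis
      using prod by (simp add: mult_ac)
  qed
qed

lemma prod_core_variance:
  assumes "n \<ge> 2" "chi \<ge> 1"
  shows "(\<Prod>p=1..n. core_variance chi n p) = 1 / real chi ^ (n - 1)"
proof -
  have "{1..n} = insert 1 (insert n {2..n-1})" using assms by auto
  then have "(\<Prod>p=1..n. core_variance chi n p) =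
      core_variance chi n 1 * (core_variance chi n n * (\<Prod>p=2..n-1. core_variance chi n p))"
    using assms by simp
  also have "(\<Prod>p=2..n-1. core_variance chi n p) = (\<Prod>p=2..n-1. 1 / real chi)"
    using assms by (intro prod.cong) (auto simp: core_variance_def)
  also have "\<dots> = 1 / real chi ^ (n - 2)"
    using assms by (simp add: power_one_over)
  also have "core_variance chi n 1 * (core_variance chi n n * (1 / real chi ^ (n - 2))) =
      1 / (real chi * real chi ^ (n - 2))"
    by (simp add: core_variance_def)
  also have "real chi * real chi ^ (n - 2) = real chi ^ (n - 1)"
    using assms by (simp add: Suc_diff_Suc numeral_2_eq_2 flip: power_Suc)
  finally show ?thesis .
qed

lemma core_variance_pos: "chi \<ge> 1 \<Longrightarrow> core_variance chi n p > 0"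
  by (simp add: core_variance_def)

lemma random_cores_moment:
  assumes "random_cores M d chi n G" "chi \<ge> 1"
    and "\<And>p. p \<in> {1..n} \<Longrightarrow> set (xs p) \<subseteq> core_keys d chi n p"
    and "\<And>p. p \<in> {1..n} \<Longrightarrow> set (ys p) \<subseteq> core_keys d chi n p"
    and "\<And>p. p \<in> {1..n} \<Longrightarrow> length (xs p) + length (ys p) \<le> 4"
  shows "has_bochner_integral M
    (\<lambda>x. \<Prod>p=1..n. (\<Prod>r\<leftarrow>xs p. G (p, r) x) * cnj (\<Prod>r\<leftarrow>ys p. G (p, r) x))
    (\<Prod>p=1..n. wick_moment (core_variance chi n p) (core_keys d chi n p) (xs p) (ys p))"
  using assms
  by (intro blockwise_moment[where v = "\<lambda>(p, _). core_variance chi n p"])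
     (auto simp: random_cores_def core_entries_eq_Sigma finite_core_keys core_variance_pos)

lemma mps_first_moment:
  assumes "random_cores M d chi n G" "chi \<ge> 1" "n \<ge> 2" "i \<in> multi_indices d n"
  shows "has_bochner_integral M (mps chi n G i) 0"
proof -
  have "has_bochner_integral M (\<lambda>x. \<Sum>\<alpha>\<in>bonds chi n. \<Prod>p=1..n. (\<Prod>r\<leftarrow>[core_key n i \<alpha> p]. G (p, r) x) *
      cnj (\<Prod>r\<leftarrow>[]. G (p, r) x))
      (\<Sum>\<alpha>\<in>bonds chi n. \<Prod>p=1..n. wick_moment (core_variance chi n p) (core_keys d chi n p) [core_key n i \<alpha> p] [])"
    using core_key_in_core_keys[OF assms(3,4)]
    by (intro has_bochner_integral_sum random_cores_moment[OF assms(1,2)]) auto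
  also have "(\<Sum>\<alpha>\<in>bonds chi n. \<Prod>p=1..n. wick_moment (core_variance chi n p) (core_keys d chi n p) [core_key n i \<alpha> p] []) = 0"
    using core_key_in_core_keys[OF assms(3,4), of _ chi 1] assms(3)
    by (intro sum.neutral ballI prod_zero bexI[of _ 1] wick_moment_eq_0[where r = "core_key n i _ 1"]
      finite_core_keys) auto
  finally show ?thesis
    by (simp add: mps_eq_sum_prod[OF assms(3), abs_def])
qed

lemma threefold_sum_product:
  fixes f g h :: "'a \<Rightarrow> 'b::comm_semiring_0"
  shows "(\<Sum>a\<in>A. f a) * ((\<Sum>b\<in>A. g b) * (\<Sum>c\<in>A. h c)) = (\<Sum>a\<in>A. \<Sum>b\<in>A. \<Sum>c\<in>A. f a * (g b * h c))"
  unfolding sum_product[of g A h A] unfolding sum_product[of f A "\<lambda>b. \<Sum>c\<in>A. g b * h c" A]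
  unfolding sum_distrib_left ..

lemma mps_third_moment:
  assumes "random_cores M d chi n G" "chi \<ge> 1" "n \<ge> 2"
    and i: "i \<in> multi_indices d n" and j: "j \<in> multi_indices d n" and k: "k \<in> multi_indices d n"
  shows "has_bochner_integral M (\<lambda>x. mps chi n G i x * mps chi n G j x * mps chi n G k x) 0"
proof -
  note key = core_key_in_core_keys[OF assms(3)]
  let ?xs = "\<lambda>\<alpha> \<beta> \<gamma> p. [core_key n i \<alpha> p, core_key n j \<beta> p, core_key n k \<gamma> p]"
  have "has_bochner_integral M (\<lambda>x. \<Sum>\<alpha>\<in>bonds chi n. \<Sum>\<beta>\<in>bonds chi n. \<Sum>\<gamma>\<in>bonds chi n.
      \<Prod>p=1..n. (\<Prod>r\<leftarrow>?xs \<alpha> \<beta> \<gamma> p. G (p, r) x) * cnj (\<Prod>r\<leftarrow>[]. G (p, r) x))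
      (\<Sum>\<alpha>\<in>bonds chi n. \<Sum>\<beta>\<in>bonds chi n. \<Sum>\<gamma>\<in>bonds chi n.
      \<Prod>p=1..n. wick_moment (core_variance chi n p) (core_keys d chi n p) (?xs \<alpha> \<beta> \<gamma> p) [])"
    using key[OF i] key[OF j] key[OF k]
    by (intro has_bochner_integral_sum random_cores_moment[OF assms(1,2)]) auto
  also have "(\<Sum>\<alpha>\<in>bonds chi n. \<Sum>\<beta>\<in>bonds chi n. \<Sum>\<gamma>\<in>bonds chi n.
      \<Prod>p=1..n. wick_moment (core_variance chi n p) (core_keys d chi n p) (?xs \<alpha> \<beta> \<gamma> p) []) = 0"
    using key[OF i, of _ chi 1] assms(3)
    by (intro sum.neutral ballI prod_zero bexI[of _ 1] wick_moment_eq_0[where r = "core_key n i _ 1"]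
      finite_core_keys) auto
  also have "(\<lambda>x. \<Sum>\<alpha>\<in>bonds chi n. \<Sum>\<beta>\<in>bonds chi n. \<Sum>\<gamma>\<in>bonds chi n.
      \<Prod>p=1..n. (\<Prod>r\<leftarrow>?xs \<alpha> \<beta> \<gamma> p. G (p, r) x) * cnj (\<Prod>r\<leftarrow>[]. G (p, r) x)) =
      (\<lambda>x. mps chi n G i x * mps chi n G j x * mps chi n G k x)"
    unfolding mps_eq_sum_prod[OF assms(3)] mult.assoc[of "sum _ _"] threefold_sum_product
    by (simp add: prod.distrib)
  finally show ?thesis .
qed

text \<open>
  Each core forces its index triples in the two factors to agree. Hence the multi-indices agree and so
  do the bond indices. The number of bond configurations cancels the product of the variances.
\<close>

lemma mps_second_moment:
  assumes "random_cores M d chi n G" "chi \<ge> 1" "n \<ge> 2"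
    and i: "i \<in> multi_indices d n" and k: "k \<in> multi_indices d n"
  shows "has_bochner_integral M (\<lambda>x. mps chi n G i x * cnj (mps chi n G k x)) (of_bool (i = k))"
proof -
  note key = core_key_in_core_keys[OF assms(3)]
  let ?W = "\<lambda>\<alpha> \<gamma> p. wick_moment (core_variance chi n p) (core_keys d chi n p)
    [core_key n i \<alpha> p] [core_key n k \<gamma> p]"
  have "has_bochner_integral M (\<lambda>x. \<Sum>\<alpha>\<in>bonds chi n. \<Sum>\<gamma>\<in>bonds chi n.
      \<Prod>p=1..n. (\<Prod>r\<leftarrow>[core_key n i \<alpha> p]. G (p, r) x) * cnj (\<Prod>r\<leftarrow>[core_key n k \<gamma> p]. G (p, r) x))
      (\<Sum>\<alpha>\<in>bonds chi n. \<Sum>\<gamma>\<in>bonds chi n. \<Prod>p=1..n. ?W \<alpha> \<gamma> p)"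
    using key[OF i] key[OF k]
    by (intro has_bochner_integral_sum random_cores_moment[OF assms(1,2)]) auto
  also have "(\<lambda>x. \<Sum>\<alpha>\<in>bonds chi n. \<Sum>\<gamma>\<in>bonds chi n.
      \<Prod>p=1..n. (\<Prod>r\<leftarrow>[core_key n i \<alpha> p]. G (p, r) x) * cnj (\<Prod>r\<leftarrow>[core_key n k \<gamma> p]. G (p, r) x)) =
      (\<lambda>x. mps chi n G i x * cnj (mps chi n G k x))"
    unfolding mps_eq_sum_prod[OF assms(3)] cnj_sum cnj_prod sum_product
    by (simp add: prod.distrib)
  also have "(\<Sum>\<alpha>\<in>bonds chi n. \<Sum>\<gamma>\<in>bonds chi n. \<Prod>p=1..n. ?W \<alpha> \<gamma> p) =
      (\<Sum>\<alpha>\<in>bonds chi n. \<Sum>\<gamma>\<in>bonds chi n. of_real (1 / real chi ^ (n - 1)) * (of_bool (i = k) * of_bool (\<alpha> = \<gamma>)))"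
  proof (intro sum.cong refl)
    fix \<alpha> \<gamma> assume \<alpha>: "\<alpha> \<in> bonds chi n" and \<gamma>: "\<gamma> \<in> bonds chi n"
    have "(\<Prod>p=1..n. ?W \<alpha> \<gamma> p) =
        (\<Prod>p=1..n. of_real (core_variance chi n p) * of_bool (core_key n i \<alpha> p = core_key n k \<gamma> p))"
      using key[OF i \<alpha>] key[OF k \<gamma>] by (intro prod.cong wick_moment_1_1 finite_core_keys) auto
    also have "\<dots> = of_real (1 / real chi ^ (n - 1)) *
        of_bool (\<forall>p\<in>{1..n}. core_key n i \<alpha> p = core_key n k \<gamma> p)"
      using prod_core_variance[OF assms(3,2)]
      by (simp only: prod.distrib prod_of_bool finite_atLeastAtMost flip: of_real_prod)
    also have "(\<forall>p\<in>{1..n}. core_key n i \<alpha> p = core_key n k \<gamma> p) \<longleftrightarrow> i = k \<and> \<alpha> = \<gamma>"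
    proof
      assume eq: "\<forall>p\<in>{1..n}. core_key n i \<alpha> p = core_key n k \<gamma> p"
      have "i = k"
        using i k eq unfolding multi_indices_def by (intro PiE_ext[of i _ _ k]) auto
      moreover have "\<alpha> = \<gamma>"
      proof (rule PiE_ext[OF \<alpha> \<gamma>])
        fix p assume p: "p \<in> {1..n-1}"
        then have "bond n \<alpha> p = bond n \<gamma> p" using eq by auto
        then show "\<alpha> p = \<gamma> p" using p by (auto simp: bond_def)
      qed
      ultimately show "i = k \<and> \<alpha> = \<gamma>" by simp
    qed auto
    finally show "(\<Prod>p=1..n. ?W \<alpha> \<gamma> p) =
        of_real (1 / real chi ^ (n - 1)) * (of_bool (i = k) * of_bool (\<alpha> = \<gamma>))"
      by simp
  qed
  also have "\<dots> = of_real (1 / real chi ^ (n - 1)) * (of_bool (i = k) * of_nat (card (bonds chi n)))"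
    by (simp add: of_bool_def finite_PiE if_distrib cong: if_cong)
  also have "\<dots> = of_bool (i = k)"
    using assms(2) by (simp add: card_PiE)
  finally show ?thesis .
qed

text \<open>
  Regrouping by bonds instead of cores: bond \<open>p\<close> is the right bond of core \<open>p\<close> and the left bond of
  core \<open>p + 1\<close>.
\<close>

lemma prod_bond_telescope:
  fixes F :: "nat \<Rightarrow> nat \<Rightarrow> complex"
  assumes "n \<ge> 2" "\<And>t. F 0 t = 1" "\<And>t. F n t = 1"
  shows "(\<Prod>p=1..n. F (p - 1) (a p) * F p (a p)) = (\<Prod>p=1..n-1. F p (a p) * F p (a (p + 1)))"
proof -
  obtain m where n: "n = Suc m" "m \<ge> 1" using assms(1) by (cases n) auto
  have "(\<Prod>p=1..n. F (p - 1) (a p)) = (\<Prod>p=0..m. F p (a (Suc p)))"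
    unfolding n by (simp add: prod.shift_bounds_cl_Suc_ivl del: prod.cl_ivl_Suc)
  also have "\<dots> = (\<Prod>p=1..m. F p (a (Suc p)))"
    using assms(2) by (simp add: prod.atLeast_Suc_atMost del: prod.cl_ivl_Suc)
  finally have "(\<Prod>p=1..n. F (p - 1) (a p)) = (\<Prod>p=1..m. F p (a (Suc p)))" .
  moreover have "(\<Prod>p=1..n. F p (a p)) = (\<Prod>p=1..m. F p (a p))"
    using assms(3) by (simp add: n)
  ultimately show ?thesis
    unfolding prod.distrib by (simp add: n mult.commute del: prod.cl_ivl_Suc)
qed

text \<open>
  For fixed bond indices, Wick's formula gives a product over the cores of sums over two matchings.
  After expansion into a sum over sequences of matchings, the sums over the bond indices
  factorise over the bonds, and \<open>fourfold_sum_pairing\<close> evaluates each of them.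
\<close>

lemma mps_fourth_moment:
  assumes "random_cores M d chi n G" "chi \<ge> 1" "n \<ge> 2"
    and i: "i \<in> multi_indices d n" and j: "j \<in> multi_indices d n"
    and k: "k \<in> multi_indices d n" and l: "l \<in> multi_indices d n"
  shows "has_bochner_integral M
    (\<lambda>x. mps chi n G i x * mps chi n G j x * cnj (mps chi n G k x * mps chi n G l x))
    (\<Sum>\<alpha> \<in> {1..n} \<rightarrow>\<^sub>E {1..2}.
       (\<Prod>p=1..n. wick_tensor (i p) (j p) (k p) (l p) (\<alpha> p)) *
       (\<Prod>p=1..n-1. transfer_matrix chi (\<alpha> p) (\<alpha> (p + 1))))"
proof -
  note key = core_key_in_core_keys[OF assms(3)]
  let ?S = "bonds chi n"
  let ?xs = "\<lambda>\<alpha> \<beta> p. [core_key n i \<alpha> p, core_key n j \<beta> p]"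
  let ?ys = "\<lambda>\<gamma> \<delta> p. [core_key n k \<gamma> p, core_key n l \<delta> p]"
  let ?W = "\<lambda>\<alpha> \<gamma> \<beta> \<delta> p. wick_moment (core_variance chi n p) (core_keys d chi n p) (?xs \<alpha> \<beta> p) (?ys \<gamma> \<delta> p)"
  let ?A = "{1..n} \<rightarrow>\<^sub>E {1..2::nat}"
  let ?T = "\<lambda>a. \<Prod>p=1..n-1. transfer_matrix chi (a p) (a (p + 1))"
  let ?Q = "\<lambda>a. \<Prod>p=1..n. wick_tensor (i p) (j p) (k p) (l p) (a p)"
  let ?v = "of_real (1 / real chi ^ (n - 1)) ^ 2 :: complex"
  let ?B = "\<lambda>\<alpha> \<gamma> \<beta> \<delta> p. pairing (bond n \<alpha> p) (bond n \<beta> p) (bond n \<gamma> p) (bond n \<delta> p)"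
  have "has_bochner_integral M (\<lambda>x. \<Sum>\<alpha>\<in>?S. \<Sum>\<gamma>\<in>?S. \<Sum>\<beta>\<in>?S. \<Sum>\<delta>\<in>?S.
      \<Prod>p=1..n. (\<Prod>r\<leftarrow>?xs \<alpha> \<beta> p. G (p, r) x) * cnj (\<Prod>r\<leftarrow>?ys \<gamma> \<delta> p. G (p, r) x))
      (\<Sum>\<alpha>\<in>?S. \<Sum>\<gamma>\<in>?S. \<Sum>\<beta>\<in>?S. \<Sum>\<delta>\<in>?S. \<Prod>p=1..n. ?W \<alpha> \<gamma> \<beta> \<delta> p)"
    using key[OF i] key[OF j] key[OF k] key[OF l]
    by (intro has_bochner_integral_sum random_cores_moment[OF assms(1,2)]) auto
  also have "(\<lambda>x. \<Sum>\<alpha>\<in>?S. \<Sum>\<gamma>\<in>?S. \<Sum>\<beta>\<in>?S. \<Sum>\<delta>\<in>?S.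
      \<Prod>p=1..n. (\<Prod>r\<leftarrow>?xs \<alpha> \<beta> p. G (p, r) x) * cnj (\<Prod>r\<leftarrow>?ys \<gamma> \<delta> p. G (p, r) x)) =
      (\<lambda>x. mps chi n G i x * mps chi n G j x * cnj (mps chi n G k x * mps chi n G l x))"
    unfolding mps_eq_sum_prod[OF assms(3)] complex_cnj_mult cnj_sum cnj_prod sum_product
    by (simp add: prod.distrib mult.assoc)
  also have "(\<Sum>\<alpha>\<in>?S. \<Sum>\<gamma>\<in>?S. \<Sum>\<beta>\<in>?S. \<Sum>\<delta>\<in>?S. \<Prod>p=1..n. ?W \<alpha> \<gamma> \<beta> \<delta> p) =
      (\<Sum>\<alpha>\<in>?S. \<Sum>\<gamma>\<in>?S. \<Sum>\<beta>\<in>?S. \<Sum>\<delta>\<in>?S. \<Sum>a\<in>?A. ?v * ?Q a *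
        (\<Prod>p=1..n-1. ?B \<alpha> \<gamma> \<beta> \<delta> p (a p) * ?B \<alpha> \<gamma> \<beta> \<delta> p (a (p + 1))))"
  proof (intro sum.cong[OF refl])
    fix \<alpha> \<gamma> \<beta> \<delta> assume *: "\<alpha> \<in> ?S" "\<gamma> \<in> ?S" "\<beta> \<in> ?S" "\<delta> \<in> ?S"
    let ?P = "\<lambda>p t. wick_tensor (i p) (j p) (k p) (l p) t"
    let ?C = "?B \<alpha> \<gamma> \<beta> \<delta>"
    have "(\<Prod>p=1..n. ?W \<alpha> \<gamma> \<beta> \<delta> p) =
        (\<Prod>p=1..n. \<Sum>t=1..2. of_real (core_variance chi n p) ^ 2 * (?P p t * (?C (p - 1) t * ?C p t)))"
    proof (rule prod.cong[OF refl])
      fix p assume p: "p \<in> {1..n}"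
      show "?W \<alpha> \<gamma> \<beta> \<delta> p =
          (\<Sum>t=1..2. of_real (core_variance chi n p) ^ 2 * (?P p t * (?C (p - 1) t * ?C p t)))"
        using key[OF i *(1) p] key[OF j *(3) p] key[OF k *(2) p] key[OF l *(4) p]
        by (subst wick_moment_2_2[OF finite_core_keys])
           (simp_all only: pairing_triple wick_tensor_eq_pairing sum_distrib_left mult_ac)
    qed
    also have "\<dots> = (\<Sum>a\<in>?A. \<Prod>p=1..n. of_real (core_variance chi n p) ^ 2 *
        (?P p (a p) * (?C (p - 1) (a p) * ?C p (a p))))"
      by (rule prod_sum_PiE) auto
    also have "\<dots> = (\<Sum>a\<in>?A. ?v * ?Q a * (\<Prod>p=1..n-1. ?C p (a p) * ?C p (a (p + 1))))"
    proof (rule sum.cong[OF refl])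
      fix a assume "a \<in> ?A"
      have v: "(\<Prod>p=1..n. of_real (core_variance chi n p) ^ 2) = ?v"
        unfolding prod_core_variance[OF assms(3,2), symmetric] by (simp add: prod_power_distrib)
      have "(\<Prod>p=1..n. of_real (core_variance chi n p) ^ 2 *
          (?P p (a p) * (?C (p - 1) (a p) * ?C p (a p)))) =
          ?v * (?Q a * (\<Prod>p=1..n. ?C (p - 1) (a p) * ?C p (a p)))"
        by (simp only: prod.distrib v)
      also have "(\<Prod>p=1..n. ?C (p - 1) (a p) * ?C p (a p)) =
          (\<Prod>p=1..n-1. ?C p (a p) * ?C p (a (p + 1)))"
        using assms(3) by (intro prod_bond_telescope) (auto simp: bond_def pairing_def)
      finally show "(\<Prod>p=1..n. of_real (core_variance chi n p) ^ 2 *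
          (?P p (a p) * (?C (p - 1) (a p) * ?C p (a p)))) =
          ?v * ?Q a * (\<Prod>p=1..n-1. ?C p (a p) * ?C p (a (p + 1)))"
        by (simp only: mult.assoc)
    qed
    finally show "(\<Prod>p=1..n. ?W \<alpha> \<gamma> \<beta> \<delta> p) =
        (\<Sum>a\<in>?A. ?v * ?Q a * (\<Prod>p=1..n-1. ?C p (a p) * ?C p (a (p + 1))))" .
  qed
  also have "\<dots> = (\<Sum>a\<in>?A. ?v * ?Q a * (\<Sum>\<alpha>\<in>?S. \<Sum>\<gamma>\<in>?S. \<Sum>\<beta>\<in>?S. \<Sum>\<delta>\<in>?S.
        (\<Prod>p=1..n-1. ?B \<alpha> \<gamma> \<beta> \<delta> p (a p) * ?B \<alpha> \<gamma> \<beta> \<delta> p (a (p + 1)))))"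
    by (simp only: sum_distrib_left sum.swap[of _ ?A])
  also have "\<dots> = (\<Sum>a\<in>?A. ?Q a * ?T a)"
  proof (rule sum.cong[OF refl])
    fix a assume a: "a \<in> ?A"
    let ?X = "{1..chi}"
    have "(\<Sum>\<alpha>\<in>?S. \<Sum>\<gamma>\<in>?S. \<Sum>\<beta>\<in>?S. \<Sum>\<delta>\<in>?S.
        (\<Prod>p=1..n-1. ?B \<alpha> \<gamma> \<beta> \<delta> p (a p) * ?B \<alpha> \<gamma> \<beta> \<delta> p (a (p + 1)))) =
        (\<Sum>\<alpha>\<in>?S. \<Sum>\<gamma>\<in>?S. \<Sum>\<beta>\<in>?S. \<Sum>\<delta>\<in>?S. (\<Prod>p=1..n-1.
          pairing (\<alpha> p) (\<beta> p) (\<gamma> p) (\<delta> p) (a p) * pairing (\<alpha> p) (\<beta> p) (\<gamma> p) (\<delta> p) (a (p + 1))))"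
      by (intro sum.cong prod.cong refl) (simp add: bond_def)
    also have "\<dots> = (\<Prod>p=1..n-1. \<Sum>x\<in>?X. \<Sum>z\<in>?X. \<Sum>y\<in>?X. \<Sum>w\<in>?X.
        pairing x y z w (a p) * pairing x y z w (a (p + 1)))"
      by (simp add: prod_sum_PiE)
    also have "\<dots> = (\<Prod>p=1..n-1. of_nat chi ^ 2 * transfer_matrix chi (a p) (a (p + 1)))"
    proof (rule prod.cong[OF refl])
      fix p assume p: "p \<in> {1..n-1}"
      have *: "a q \<in> {1, 2}" if "q \<in> {1..n}" for q
      proof -
        have "a q \<in> {1..2}" using PiE_mem[OF a that] .
        then show ?thesis by auto
      qed
      have "a p \<in> {1, 2}" "a (p + 1) \<in> {1, 2}" using p assms(3) by (intro *; auto)+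
      from fourfold_sum_pairing[OF _ this, of ?X]
      show "(\<Sum>x\<in>?X. \<Sum>z\<in>?X. \<Sum>y\<in>?X. \<Sum>w\<in>?X.
          pairing x y z w (a p) * pairing x y z w (a (p + 1))) =
          of_nat chi ^ 2 * transfer_matrix chi (a p) (a (p + 1))"
        using assms(2) by (simp add: transfer_matrix_def power2_eq_square)
    qed
    also have "\<dots> = (of_nat chi ^ 2) ^ (n - 1) * ?T a"
      by (simp add: prod.distrib)
    finally have "?v * ?Q a * (\<Sum>\<alpha>\<in>?S. \<Sum>\<gamma>\<in>?S. \<Sum>\<beta>\<in>?S. \<Sum>\<delta>\<in>?S.
        (\<Prod>p=1..n-1. ?B \<alpha> \<gamma> \<beta> \<delta> p (a p) * ?B \<alpha> \<gamma> \<beta> \<delta> p (a (p + 1)))) =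
        ?v * (of_nat chi ^ 2) ^ (n - 1) * (?Q a * ?T a)"
      by (simp only: mult_ac)
    also have "?v * (of_nat chi ^ 2) ^ (n - 1) = 1"
      using assms(2) by (simp add: power_divide power_mult[symmetric] mult.commute)
    finally show "?v * ?Q a * (\<Sum>\<alpha>\<in>?S. \<Sum>\<gamma>\<in>?S. \<Sum>\<beta>\<in>?S. \<Sum>\<delta>\<in>?S.
        (\<Prod>p=1..n-1. ?B \<alpha> \<gamma> \<beta> \<delta> p (a p) * ?B \<alpha> \<gamma> \<beta> \<delta> p (a (p + 1)))) = ?Q a * ?T a"
      by simp
  qed
  finally show ?thesis .
qed

section \<open>Compositions and colourings of their parts\<close>

lemma length_break_list:
  "length (0 # filter \<beta> [1..<n] @ [n]) = Suc (num_parts n \<beta>)"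
proof -
  have "length (filter \<beta> [1..<n]) = card (set (filter \<beta> [1..<n]))"
    by (rule distinct_card[symmetric]) simp
  also have "set (filter \<beta> [1..<n]) = {p \<in> {1..n-1}. \<beta> p}" by auto
  finally show ?thesis by (simp add: num_parts_def)
qed

lemma set_break_list:
  assumes "n \<ge> 1"
  shows "set (0 # filter \<beta> [1..<n] @ [n]) = {0, n} \<union> {p \<in> {1..n-1}. \<beta> p}"
  using assms by auto

lemma break_point_strict_mono:
  assumes "n \<ge> 1" "q < r" "r \<le> num_parts n \<beta>"
  shows "break_point n \<beta> q < break_point n \<beta> r"
proof -
  have "sorted_wrt (<) (0 # filter \<beta> [1..<n] @ [n])"
    using assms(1) by (auto simp: sorted_wrt_append intro: sorted_wrt_filter)
  then show ?thesis
    unfolding break_point_def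
    by (rule sorted_wrt_nth_less) (use assms length_break_list[of \<beta> n] in auto)
qed

lemma break_point_0: "break_point n \<beta> 0 = 0"
  by (simp add: break_point_def)

lemma break_point_last: "break_point n \<beta> (num_parts n \<beta>) = n"
  using length_break_list[of \<beta> n] by (auto simp: break_point_def nth_append nth_Cons')

lemma num_parts_pos: "num_parts n \<beta> \<ge> 1"
  by (simp add: num_parts_def)

lemma break_point_inner:
  assumes "n \<ge> 1" "0 < q" "q < num_parts n \<beta>"
  shows "break_point n \<beta> q \<in> {1..n-1} \<and> \<beta> (break_point n \<beta> q)"
proof -
  have "break_point n \<beta> q \<in> set (0 # filter \<beta> [1..<n] @ [n])"
    unfolding break_point_def using assms length_break_list[of \<beta> n] by (intro nth_mem) simp
  moreover have "0 < break_point n \<beta> q"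
    using break_point_strict_mono[OF assms(1), of 0 q \<beta>] assms by (simp add: break_point_0)
  moreover have "break_point n \<beta> q < n"
    using break_point_strict_mono[OF assms(1), of q "num_parts n \<beta>" \<beta>] assms by (simp add: break_point_last)
  ultimately show ?thesis
    unfolding set_break_list[OF assms(1)] by auto
qed

lemma break_point_surj:
  assumes "n \<ge> 1" "p \<in> {1..n-1}" "\<beta> p"
  obtains q where "q \<le> num_parts n \<beta>" "break_point n \<beta> q = p"
proof -
  have "p \<in> set (0 # filter \<beta> [1..<n] @ [n])"
    unfolding set_break_list[OF assms(1)] using assms by auto
  then obtain q where "q < Suc (num_parts n \<beta>)" "(0 # filter \<beta> [1..<n] @ [n]) ! q = p"
    unfolding in_set_conv_nth length_break_list by auto
  then show ?thesis using that[of q] by (simp add: break_point_def)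
qed

lemma break_point_less_iff:
  assumes "n \<ge> 1" "q \<le> num_parts n \<beta>" "r \<le> num_parts n \<beta>"
  shows "break_point n \<beta> q < break_point n \<beta> r \<longleftrightarrow> q < r"
  using break_point_strict_mono[OF assms(1), of q r \<beta>] break_point_strict_mono[OF assms(1), of r q \<beta>] assms
  by (cases q r rule: linorder_cases) auto

abbreviation part_positions :: "nat \<Rightarrow> (nat \<Rightarrow> bool) \<Rightarrow> nat \<Rightarrow> nat set" where
  "part_positions n \<beta> q \<equiv> {break_point n \<beta> (q - 1)<..break_point n \<beta> q}"

definition part_of :: "nat \<Rightarrow> (nat \<Rightarrow> bool) \<Rightarrow> nat \<Rightarrow> nat" where
  "part_of n \<beta> p = (LEAST q. p \<le> break_point n \<beta> q)"

text \<open>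
  The parts cover \<open>{1..n}\<close>, as the break points increase from \<open>0\<close> to \<open>n\<close>.
\<close>

lemma part_of:
  assumes "n \<ge> 1" "p \<in> {1..n}"
  shows "part_of n \<beta> p \<in> {1..num_parts n \<beta>}" "p \<in> part_positions n \<beta> (part_of n \<beta> p)"
proof -
  let ?q = "part_of n \<beta> p"
  have le: "p \<le> break_point n \<beta> ?q"
    unfolding part_of_def
    by (rule LeastI[of "\<lambda>q. p \<le> break_point n \<beta> q" "num_parts n \<beta>"]) (use assms in \<open>simp add: break_point_last\<close>)
  have "?q \<le> num_parts n \<beta>"
    unfolding part_of_def by (rule Least_le) (use assms in \<open>simp add: break_point_last\<close>)
  moreover have "?q \<noteq> 0"
  proof
    assume "?q = 0"
    then show False using le assms by (simp add: break_point_0)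
  qed
  ultimately show "?q \<in> {1..num_parts n \<beta>}" by auto
  have "\<not> p \<le> break_point n \<beta> (?q - 1)"
    using not_less_Least[of "?q - 1" "\<lambda>q. p \<le> break_point n \<beta> q"] \<open>?q \<noteq> 0\<close> unfolding part_of_def by auto
  then show "p \<in> part_positions n \<beta> ?q" using le by auto
qed

lemma part_of_unique:
  assumes "n \<ge> 1" "q \<in> {1..num_parts n \<beta>}" "p \<in> part_positions n \<beta> q"
  shows "p \<in> {1..n}" "part_of n \<beta> p = q"
proof -
  have "break_point n \<beta> q \<le> n"
    using break_point_strict_mono[OF assms(1), of q "num_parts n \<beta>" \<beta>] assms(2)
    by (cases "q = num_parts n \<beta>") (auto simp: break_point_last)
  then show p: "p \<in> {1..n}" using assms(3) by auto
  show "part_of n \<beta> p = q"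
    unfolding part_of_def
  proof (rule Least_equality)
    fix r assume "p \<le> break_point n \<beta> r"
    then have *: "break_point n \<beta> (q - 1) < break_point n \<beta> r" using assms(3) by auto
    show "q \<le> r"
    proof (rule ccontr)
      assume "\<not> q \<le> r"
      then have "r = q - 1 \<or> r < q - 1" by auto
      moreover have "q - 1 \<le> num_parts n \<beta>" using assms(2) by auto
      ultimately show False
        using * break_point_strict_mono[OF assms(1), of r "q - 1" \<beta>] by auto
    qed
  qed (use assms(3) in auto)
qed

lemma prod_over_parts:
  fixes f :: "nat \<Rightarrow> nat \<Rightarrow> 'b::comm_monoid_mult"
  assumes "n \<ge> 1"
  shows "(\<Prod>q=1..num_parts n \<beta>. \<Prod>p\<in>part_positions n \<beta> q. f q p) = (\<Prod>p=1..n. f (part_of n \<beta> p) p)"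
proof -
  have "(\<Prod>q=1..num_parts n \<beta>. \<Prod>p\<in>part_positions n \<beta> q. f q p) =
      (\<Prod>(q, p)\<in>(SIGMA q:{1..num_parts n \<beta>}. part_positions n \<beta> q). f q p)"
    by (rule prod.Sigma) auto
  also have "\<dots> = (\<Prod>p=1..n. f (part_of n \<beta> p) p)"
  proof (rule prod.reindex_bij_witness[of _ "\<lambda>p. (part_of n \<beta> p, p)" snd])
    fix x assume "x \<in> (SIGMA q:{1..num_parts n \<beta>}. part_positions n \<beta> q)"
    then obtain q p where x: "x = (q, p)" "q \<in> {1..num_parts n \<beta>}" "p \<in> part_positions n \<beta> q" by blast
    show "(part_of n \<beta> (snd x), snd x) = x" "snd x \<in> {1..n}"
      "f (part_of n \<beta> (snd x)) (snd x) = (case x of (q, p) \<Rightarrow> f q p)"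
      using part_of_unique[OF assms x(2,3)] by (simp_all add: x(1))
  next
    fix p assume p: "p \<in> {1..n}"
    show "(part_of n \<beta> p, p) \<in> (SIGMA q:{1..num_parts n \<beta>}. part_positions n \<beta> q)"
      using part_of[OF assms p] by (rule SigmaI)
  qed simp
  finally show ?thesis .
qed

text \<open>
  Consecutive positions are in different parts only if there is a break between them.
\<close>

lemma part_of_Suc:
  assumes "n \<ge> 1" "p \<in> {1..n-1}" "\<not> \<beta> p"
  shows "part_of n \<beta> (p + 1) = part_of n \<beta> p"
proof -
  let ?q = "part_of n \<beta> p"
  have p: "p \<in> {1..n}" using assms by auto
  note q = part_of[OF assms(1) p, of \<beta>]
  have "p \<noteq> break_point n \<beta> ?q"
  proof
    assume eq: "p = break_point n \<beta> ?q"
    show False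
    proof (cases "?q = num_parts n \<beta>")
      case True
      then have "break_point n \<beta> ?q = n" by (simp add: break_point_last)
      then show False using assms(2) unfolding eq[symmetric] by auto
    next
      case False
      then have "\<beta> (break_point n \<beta> ?q)"
        using break_point_inner[OF assms(1), of ?q \<beta>] q(1) by auto
      then show False using assms(3) unfolding eq[symmetric] by simp
    qed
  qed
  then have "p + 1 \<in> part_positions n \<beta> ?q" using q by auto
  then show ?thesis by (rule part_of_unique(2)[OF assms(1) q(1)])
qed

lemma constant_on_part:
  assumes n: "n \<ge> 1" and a: "\<forall>p\<in>{1..n-1}. \<beta> p \<or> a p = a (p + 1)" and q: "q \<in> {1..num_parts n \<beta>}"
    and p: "p \<in> part_positions n \<beta> q"
  shows "a p = a (break_point n \<beta> q)"
proof -
  have "p \<le> break_point n \<beta> q" using p by auto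
  then have "break_point n \<beta> (q - 1) < p \<longrightarrow> a p = a (break_point n \<beta> q)"
  proof (induction rule: inc_induct)
    case (step m)
    show ?case
    proof
      assume m: "break_point n \<beta> (q - 1) < m"
      then have mp: "m \<in> part_positions n \<beta> q" using step by auto
      have "break_point n \<beta> q \<le> n"
        using part_of_unique(1)[OF n q, of "break_point n \<beta> q"] p by auto
      then have mn: "m \<in> {1..n-1}" using m step by auto
      have "\<not> \<beta> m"
      proof
        assume "\<beta> m"
        then obtain r where r: "r \<le> num_parts n \<beta>" "break_point n \<beta> r = m"
          using break_point_surj[OF n mn] by blast
        then have "q - 1 < r" "r < q"
          using m step(2) q break_point_less_iff[OF n, of "q - 1" \<beta> r] break_point_less_iff[OF n, of r \<beta> q]
          by auto
        then show False by auto
      qed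
      then have "a m = a (Suc m)" using a mn by auto
      then show "a m = a (break_point n \<beta> q)" using step m by auto
    qed
  qed auto
  then show ?thesis using p by auto
qed

text \<open>
  Choosing a colour for every part is the same as choosing a colouring of the positions that is
  constant on the parts, that is, one that changes from \<open>p\<close> to \<open>p + 1\<close> only if \<open>\<beta> p\<close> holds. The last
  form is a product over the positions, which makes the average over a random \<open>\<beta>\<close> factorise.
\<close>

lemma sum_colourings_of_parts:
  fixes w :: "nat \<Rightarrow> 'c \<Rightarrow> 'b::comm_semiring_1"
  assumes n: "n \<ge> 1" and C: "finite C"
  shows "(\<Prod>q=1..num_parts n \<beta>. \<Sum>s\<in>C. \<Prod>p\<in>part_positions n \<beta> q. w p s) =
    (\<Sum>a\<in>{1..n} \<rightarrow>\<^sub>E C. (\<Prod>p=1..n. w p (a p)) * (\<Prod>p=1..n-1. of_bool (\<beta> p \<or> a p = a (p + 1))))"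
proof -
  let ?t = "num_parts n \<beta>" and ?e = "break_point n \<beta>" and ?b = "part_of n \<beta>"
  let ?ok = "\<lambda>a. \<forall>p\<in>{1..n-1}. \<beta> p \<or> a p = a (p + 1)"
  have ein: "?e q \<in> part_positions n \<beta> q" "?e q \<in> {1..n}" "?b (?e q) = q" if "q \<in> {1..?t}" for q
  proof -
    show "?e q \<in> part_positions n \<beta> q"
      using break_point_strict_mono[OF n, of "q - 1" q \<beta>] that by auto
    then show "?e q \<in> {1..n}" "?b (?e q) = q" using part_of_unique[OF n that] by auto
  qed
  have "(\<Prod>q=1..?t. \<Sum>s\<in>C. \<Prod>p\<in>part_positions n \<beta> q. w p s) =
      (\<Sum>c\<in>{1..?t} \<rightarrow>\<^sub>E C. \<Prod>q=1..?t. \<Prod>p\<in>part_positions n \<beta> q. w p (c q))"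
    using C by (intro prod_sum_PiE) auto
  also have "\<dots> = (\<Sum>c\<in>{1..?t} \<rightarrow>\<^sub>E C. \<Prod>p=1..n. w p (c (?b p)))"
    by (simp only: prod_over_parts[OF n])
  also have "\<dots> = (\<Sum>a\<in>{a \<in> {1..n} \<rightarrow>\<^sub>E C. ?ok a}. \<Prod>p=1..n. w p (a p))"
  proof (rule sum.reindex_bij_witness[of _ "\<lambda>a. \<lambda>q\<in>{1..?t}. a (?e q)" "\<lambda>c. \<lambda>p\<in>{1..n}. c (?b p)"])
    fix c assume c: "c \<in> {1..?t} \<rightarrow>\<^sub>E C"
    show "(\<lambda>q\<in>{1..?t}. (\<lambda>p\<in>{1..n}. c (?b p)) (?e q)) = c"
      using ein c by (intro PiE_ext[OF _ c]) (auto simp: PiE_iff)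
    have "?ok (\<lambda>p\<in>{1..n}. c (?b p))"
    proof
      fix p assume p: "p \<in> {1..n-1}"
      then have "p \<in> {1..n}" "p + 1 \<in> {1..n}" by auto
      then show "\<beta> p \<or> (\<lambda>p\<in>{1..n}. c (?b p)) p = (\<lambda>p\<in>{1..n}. c (?b p)) (p + 1)"
        using part_of_Suc[OF n p] by (cases "\<beta> p") simp_all
    qed
    moreover have "(\<lambda>p\<in>{1..n}. c (?b p)) \<in> {1..n} \<rightarrow>\<^sub>E C"
      using part_of(1)[OF n] c by (auto simp: PiE_iff)
    ultimately show "(\<lambda>p\<in>{1..n}. c (?b p)) \<in> {a \<in> {1..n} \<rightarrow>\<^sub>E C. ?ok a}" by blast
    show "(\<Prod>p=1..n. w p ((\<lambda>p\<in>{1..n}. c (?b p)) p)) = (\<Prod>p=1..n. w p (c (?b p)))"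
      by (intro prod.cong) auto
  next
    fix a assume a: "a \<in> {a \<in> {1..n} \<rightarrow>\<^sub>E C. ?ok a}"
    then have aC: "a \<in> {1..n} \<rightarrow>\<^sub>E C" and ok: "?ok a" by auto
    show "(\<lambda>q\<in>{1..?t}. a (?e q)) \<in> {1..?t} \<rightarrow>\<^sub>E C"
      using ein(2) aC by (auto simp: PiE_iff)
    show "(\<lambda>p\<in>{1..n}. (\<lambda>q\<in>{1..?t}. a (?e q)) (?b p)) = a"
    proof (rule PiE_ext[OF _ aC])
      show "(\<lambda>p\<in>{1..n}. (\<lambda>q\<in>{1..?t}. a (?e q)) (?b p)) \<in> {1..n} \<rightarrow>\<^sub>E C"
        using part_of(1)[OF n] ein(2) aC by (auto simp: PiE_iff)
      fix p assume p: "p \<in> {1..n}"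
      then show "(\<lambda>p\<in>{1..n}. (\<lambda>q\<in>{1..?t}. a (?e q)) (?b p)) p = a p"
        using part_of[OF n p, of \<beta>] constant_on_part[OF n ok, of "?b p" p] by auto
    qed
  qed
  also have "\<dots> = (\<Sum>a\<in>{1..n} \<rightarrow>\<^sub>E C. (\<Prod>p=1..n. w p (a p)) * of_bool (?ok a))"
    using C by (intro sum.mono_neutral_cong_left) (auto simp: finite_PiE)
  finally show ?thesis by (simp only: prod_of_bool[OF finite_atLeastAtMost])
qed

text \<open>
  The piece of the multi-index \<open>i\<close> that belongs to part \<open>q\<close>, shifted to start at position \<open>1\<close>.
\<close>

definition segment :: "nat \<Rightarrow> (nat \<Rightarrow> bool) \<Rightarrow> nat \<Rightarrow> (nat \<Rightarrow> nat) \<Rightarrow> nat \<Rightarrow> nat" where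
  "segment n \<beta> q i = (\<lambda>r\<in>{1..part_size n \<beta> q}. i (break_point n \<beta> (q - 1) + r))"

lemma segment_in_multi_indices:
  assumes "n \<ge> 1" "i \<in> multi_indices d n" "q \<in> {1..num_parts n \<beta>}"
  shows "segment n \<beta> q i \<in> multi_indices d (part_size n \<beta> q)"
proof -
  have "i (break_point n \<beta> (q - 1) + r) \<in> {1..d}" if "r \<in> {1..part_size n \<beta> q}" for r
  proof -
    have "break_point n \<beta> (q - 1) + r \<in> part_positions n \<beta> q"
      using that by (auto simp: part_size_def)
    then have "break_point n \<beta> (q - 1) + r \<in> {1..n}"
      using part_of_unique(1)[OF assms(1,3)] by blast
    then show ?thesis using assms(2) by (auto simp: multi_indices_def)
  qed
  then show ?thesis by (auto simp: multi_indices_def segment_def)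
qed

lemma segment_eq_iff:
  "segment n \<beta> q i = segment n \<beta> q k \<longleftrightarrow> (\<forall>p\<in>part_positions n \<beta> q. i p = k p)"
proof
  assume eq: "segment n \<beta> q i = segment n \<beta> q k"
  show "\<forall>p\<in>part_positions n \<beta> q. i p = k p"
  proof
    fix p assume p: "p \<in> part_positions n \<beta> q"
    have "segment n \<beta> q i (p - break_point n \<beta> (q - 1)) = segment n \<beta> q k (p - break_point n \<beta> (q - 1))"
      by (simp only: eq)
    then show "i p = k p" using p by (auto simp: part_size_def segment_def split: if_splits)
  qed
next
  assume "\<forall>p\<in>part_positions n \<beta> q. i p = k p"
  then show "segment n \<beta> q i = segment n \<beta> q k"
    unfolding segment_def by (intro restrict_ext) (auto simp: part_size_def)
qed

lemma pairing_segment: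
  "pairing (segment n \<beta> q i) (segment n \<beta> q j) (segment n \<beta> q k) (segment n \<beta> q l) s =
    (\<Prod>p\<in>part_positions n \<beta> q. pairing (i p) (j p) (k p) (l p) s)"
  by (cases "s = 1")
     (simp_all only: pairing_def segment_eq_iff refl if_True if_False prod.distrib
        prod_of_bool[OF finite_greaterThanAtMost])

section \<open>Moments of the random Gaussian tensor product\<close>

lemma finite_multi_indices: "finite (multi_indices d n)"
  by (simp add: multi_indices_def finite_PiE)

text \<open>
  For a fixed composition the blocks of independent Gaussians are the parts.
\<close>

lemma composition_tensor_moment:
  assumes g: "indep_complex_normals M' (\<lambda>(q, i). g q i) (\<lambda>_. 1)
      (SIGMA q:{1..num_parts n \<beta>}. multi_indices d (part_size n \<beta> q))"
    and n: "n \<ge> 1"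
    and us: "set us \<subseteq> multi_indices d n" "set vs \<subseteq> multi_indices d n" "length us + length vs \<le> 4"
  shows "has_bochner_integral M'
    (\<lambda>x. (\<Prod>i\<leftarrow>us. composition_tensor n \<beta> (\<lambda>q i'. g q i' x) i) *
         cnj (\<Prod>k\<leftarrow>vs. composition_tensor n \<beta> (\<lambda>q i'. g q i' x) k))
    (\<Prod>q=1..num_parts n \<beta>. wick_moment 1 (multi_indices d (part_size n \<beta> q))
       (map (segment n \<beta> q) us) (map (segment n \<beta> q) vs))"
proof -
  let ?h = "\<lambda>x. composition_tensor n \<beta> (\<lambda>q i'. g q i' x)"
  have seg: "set (map (segment n \<beta> q) js) \<subseteq> multi_indices d (part_size n \<beta> q)"
    if "set js \<subseteq> multi_indices d n" "q \<in> {1..num_parts n \<beta>}" for js q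
    using segment_in_multi_indices[OF n _ that(2)] that(1) by auto
  have swap: "(\<Prod>i\<leftarrow>js. ?h x i) =
      (\<Prod>q=1..num_parts n \<beta>. \<Prod>r\<leftarrow>map (segment n \<beta> q) js. g q r x)" for js x
    unfolding composition_tensor_def segment_def[symmetric]
    by (induction js) (simp_all add: prod.distrib)
  have "has_bochner_integral M'
    (\<lambda>x. \<Prod>q=1..num_parts n \<beta>. (\<Prod>r\<leftarrow>map (segment n \<beta> q) us. (case (q, r) of (q, i) \<Rightarrow> g q i) x) *
       cnj (\<Prod>r\<leftarrow>map (segment n \<beta> q) vs. (case (q, r) of (q, i) \<Rightarrow> g q i) x))
    (\<Prod>q=1..num_parts n \<beta>. wick_moment 1 (multi_indices d (part_size n \<beta> q))
       (map (segment n \<beta> q) us) (map (segment n \<beta> q) vs))"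
    using us(3) by (intro blockwise_moment[OF g] seg[OF us(1)] seg[OF us(2)] finite_multi_indices) auto
  then show ?thesis
    unfolding swap by (simp add: prod.distrib)
qed

lemma num_parts_cong:
  assumes "\<forall>p\<in>{1..n-1}. \<beta> p = \<beta>' p"
  shows "num_parts n \<beta> = num_parts n \<beta>'"
proof -
  have "{p \<in> {1..n-1}. \<beta> p} = {p \<in> {1..n-1}. \<beta>' p}" using assms by auto
  then show ?thesis by (simp only: num_parts_def)
qed

lemma break_point_cong:
  assumes "\<forall>p\<in>{1..n-1}. \<beta> p = \<beta>' p"
  shows "break_point n \<beta> = break_point n \<beta>'"
proof -
  have "filter \<beta> [1..<n] = filter \<beta>' [1..<n]"
    using assms by (intro filter_cong) auto
  then show ?thesis by (intro ext) (simp only: break_point_def)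
qed

lemma composition_tensor_cong:
  assumes "\<forall>p\<in>{1..n-1}. \<beta> p = \<beta>' p"
  shows "composition_tensor n \<beta> g i = composition_tensor n \<beta>' g i"
  unfolding composition_tensor_def part_size_def
  by (simp only: num_parts_cong[OF assms] break_point_cong[OF assms])

text \<open>
  The contribution of an event to an expectation, from the conditional expectation. On a null event
  nothing is known about \<open>F\<close>, but the contribution vanishes.
\<close>

lemma (in prob_space) has_bochner_integral_indicator_uniform_measure:
  fixes F :: "'a \<Rightarrow> complex"
  assumes E: "E \<in> events" and F: "F \<in> borel_measurable M"
    and cond: "prob E > 0 \<Longrightarrow> has_bochner_integral (uniform_measure M E) F c"
  shows "has_bochner_integral M (\<lambda>x. indicator E x *\<^sub>R F x) (prob E *\<^sub>R c)"
proof (cases "prob E > 0")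
  case True
  have [measurable]: "E \<in> events" by fact
  have E0: "emeasure M E = ennreal (prob E)" by (rule emeasure_eq_measure)
  have "uniform_measure M E = density M (\<lambda>x. ennreal (indicator E x / prob E))"
    unfolding uniform_measure_def E0
    by (rule density_cong)
       (measurable, use True in \<open>auto simp: divide_ennreal ennreal_indicator[symmetric]\<close>)
  then have "has_bochner_integral (density M (\<lambda>x. ennreal (indicator E x / prob E))) F c"
    using cond[OF True] by simp
  then have "has_bochner_integral M (\<lambda>x. (indicator E x / prob E) *\<^sub>R F x) c"
    using E F by (simp add: has_bochner_integral_iff integrable_density integral_density)
  from has_bochner_integral_scaleR_right[OF this, of "prob E"]
  show ?thesis using True by simp
next
  case False
  then have "prob E = 0" using measure_nonneg[of M E] by linarith
  then have "AE x in M. x \<notin> E"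
    using E by (intro AE_not_in) (auto simp: null_sets_def emeasure_eq_measure)
  then have "AE x in M. indicator E x *\<^sub>R F x = 0"
    by eventually_elim simp
  moreover have "(\<lambda>x. indicator E x *\<^sub>R F x) \<in> borel_measurable M"
    using E F by measurable
  ultimately have "has_bochner_integral M (\<lambda>x. indicator E x *\<^sub>R F x) 0 \<longleftrightarrow> has_bochner_integral M (\<lambda>x. 0) (0::complex)"
    by (intro has_bochner_integral_cong_AE) auto
  then show ?thesis using \<open>prob E = 0\<close> by (simp add: has_bochner_integral_zero)
qed

lemma prob_pattern_of_indep_pmfs:
  assumes "prob_space N" "prob_space.indep_vars N (\<lambda>_. count_space UNIV) b I"
    and I: "finite I" "I \<noteq> {}"
    and law: "\<forall>p\<in>I. distr N (count_space UNIV) (b p) = measure_pmf (Q p)"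
  shows "{y \<in> space N. \<forall>p\<in>I. b p y = \<beta> p} \<in> sets N"
    and "measure N {y \<in> space N. \<forall>p\<in>I. b p y = \<beta> p} = (\<Prod>p\<in>I. pmf (Q p) (\<beta> p))"
proof -
  interpret prob_space N by fact
  have meas: "b p \<in> measurable N (count_space UNIV)" if "p \<in> I" for p
    using assms(2) that by (auto simp: indep_vars_def)
  have E: "{y \<in> space N. \<forall>p\<in>I. b p y = \<beta> p} = (\<Inter>p\<in>I. b p -` {\<beta> p} \<inter> space N)"
    using I by auto
  show "{y \<in> space N. \<forall>p\<in>I. b p y = \<beta> p} \<in> sets N"
    unfolding E using I meas by (intro sets.finite_INT) (auto intro: measurable_sets)
  have "prob (\<Inter>p\<in>I. b p -` {\<beta> p} \<inter> space N) = (\<Prod>p\<in>I. prob (b p -` {\<beta> p} \<inter> space N))"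
    using I by (intro indep_varsD_finite[OF assms(2)]) auto
  also have "\<dots> = (\<Prod>p\<in>I. pmf (Q p) (\<beta> p))"
  proof (rule prod.cong[OF refl])
    fix p assume p: "p \<in> I"
    have "prob (b p -` {\<beta> p} \<inter> space N) = measure (distr N (count_space UNIV) (b p)) {\<beta> p}"
      using meas[OF p] by (subst measure_distr) auto
    also have "\<dots> = pmf (Q p) (\<beta> p)" using law p by (simp add: measure_pmf_single)
    finally show "prob (b p -` {\<beta> p} \<inter> space N) = pmf (Q p) (\<beta> p)" .
  qed
  finally show "measure N {y \<in> space N. \<forall>p\<in>I. b p y = \<beta> p} = (\<Prod>p\<in>I. pmf (Q p) (\<beta> p))"
    unfolding E .
qed

text \<open>
  The law of total expectation over the values \<open>\<beta>\<close> of \<open>b\<close>. Values on \<open>{1..n-1}\<close> determine the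
  composition, so that the extensional functions on this set represent all cases once.
\<close>

lemma random_composition_moment:
  assumes N: "random_composition_gaussians N d chi n b g" and n: "n \<ge> 2"
    and us: "set us \<subseteq> multi_indices d n" "set vs \<subseteq> multi_indices d n" "length us + length vs \<le> 4"
  shows "has_bochner_integral N
    (\<lambda>y. (\<Prod>i\<leftarrow>us. random_composition_tensor n b g i y) * cnj (\<Prod>k\<leftarrow>vs. random_composition_tensor n b g k y))
    (\<Sum>\<beta>\<in>{1..n-1} \<rightarrow>\<^sub>E UNIV. (\<Prod>p=1..n-1. of_real (pmf (bernoulli_pmf (1 / real chi)) (\<beta> p))) *
      (\<Prod>q=1..num_parts n \<beta>. wick_moment 1 (multi_indices d (part_size n \<beta> q))
       (map (segment n \<beta> q) us) (map (segment n \<beta> q) vs)))"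
proof -
  interpret prob_space N using N by (simp add: random_composition_gaussians_def)
  define E where "E \<beta> = {y \<in> space N. \<forall>p\<in>{1..n-1}. b p y = \<beta> p}" for \<beta>
  define K where "K \<beta> = (SIGMA q:{1..num_parts n \<beta>}. multi_indices d (part_size n \<beta> q))" for \<beta>
  define F where "F \<beta> y = (\<Prod>i\<leftarrow>us. composition_tensor n \<beta> (\<lambda>q i'. g q i' y) i) *
    cnj (\<Prod>k\<leftarrow>vs. composition_tensor n \<beta> (\<lambda>q i'. g q i' y) k)" for \<beta> y
  define c where "c \<beta> = (\<Prod>q=1..num_parts n \<beta>. wick_moment 1 (multi_indices d (part_size n \<beta> q))
       (map (segment n \<beta> q) us) (map (segment n \<beta> q) vs))" for \<beta>
  have b: "indep_vars (\<lambda>_. count_space UNIV) b {1..n-1}"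
    "\<forall>p\<in>{1..n-1}. distr N (count_space UNIV) (b p) = measure_pmf (bernoulli_pmf (1 / real chi))"
    and gm: "\<And>\<beta> q i. (q, i) \<in> K \<beta> \<Longrightarrow> g q i \<in> borel_measurable N"
    and gi: "\<And>\<beta>. prob (E \<beta>) > 0 \<Longrightarrow>
      indep_complex_normals (uniform_measure N (E \<beta>)) (\<lambda>(q, i). g q i) (\<lambda>_. 1) (K \<beta>)"
    using N unfolding random_composition_gaussians_def E_def K_def Let_def by blast+
  have ne: "{1..n-1} \<noteq> {}" using n by auto
  note E = prob_pattern_of_indep_pmfs[OF prob_space_axioms b(1) _ ne b(2), folded E_def, simplified]
  have tm: "(\<lambda>y. composition_tensor n \<beta> (\<lambda>q i'. g q i' y) i) \<in> borel_measurable N"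
    if "i \<in> multi_indices d n" for \<beta> i
    unfolding composition_tensor_def segment_def[symmetric]
  proof (intro borel_measurable_prod gm[of _ _ \<beta>])
    fix q assume "q \<in> {1..num_parts n \<beta>}"
    then show "(q, segment n \<beta> q i) \<in> K \<beta>"
      unfolding K_def using n that by (intro SigmaI segment_in_multi_indices) auto
  qed
  have lm: "(\<lambda>y. \<Prod>i\<leftarrow>js. composition_tensor n \<beta> (\<lambda>q i'. g q i' y) i) \<in> borel_measurable N"
    if "set js \<subseteq> multi_indices d n" for \<beta> js
    using that by (induction js) (auto intro!: borel_measurable_times tm)
  have Fm: "F \<beta> \<in> borel_measurable N" for \<beta>
    unfolding F_def using lm[OF us(1)] lm[OF us(2)] by measurable
  have "has_bochner_integral N (\<lambda>y. \<Sum>\<beta>\<in>{1..n-1} \<rightarrow>\<^sub>E UNIV. indicator (E \<beta>) y *\<^sub>R F \<beta> y)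
      (\<Sum>\<beta>\<in>{1..n-1} \<rightarrow>\<^sub>E UNIV. prob (E \<beta>) *\<^sub>R c \<beta>)"
  proof (intro has_bochner_integral_sum has_bochner_integral_indicator_uniform_measure E(1) Fm)
    fix \<beta> assume "prob (E \<beta>) > 0"
    from composition_tensor_moment[OF gi[OF this, unfolded K_def] _ us]
    show "has_bochner_integral (uniform_measure N (E \<beta>)) (F \<beta>) (c \<beta>)"
      unfolding F_def c_def using n by simp
  qed
  also have "(\<Sum>\<beta>\<in>{1..n-1} \<rightarrow>\<^sub>E UNIV. prob (E \<beta>) *\<^sub>R c \<beta>) =
      (\<Sum>\<beta>\<in>{1..n-1} \<rightarrow>\<^sub>E UNIV. (\<Prod>p=1..n-1. of_real (pmf (bernoulli_pmf (1 / real chi)) (\<beta> p))) * c \<beta>)"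
    by (simp add: E(2) scaleR_conv_of_real)
  finally have *: "has_bochner_integral N (\<lambda>y. \<Sum>\<beta>\<in>{1..n-1} \<rightarrow>\<^sub>E UNIV. indicator (E \<beta>) y *\<^sub>R F \<beta> y)
      (\<Sum>\<beta>\<in>{1..n-1} \<rightarrow>\<^sub>E UNIV. (\<Prod>p=1..n-1. of_real (pmf (bernoulli_pmf (1 / real chi)) (\<beta> p))) * c \<beta>)" .
  show ?thesis
  proof (rule has_bochner_integral_cong[THEN iffD1, OF refl _ _ *])
    fix y assume y: "y \<in> space N"
    define \<beta>0 where "\<beta>0 = (\<lambda>p\<in>{1..n-1}. b p y)"
    have \<beta>0: "\<beta>0 \<in> {1..n-1} \<rightarrow>\<^sub>E UNIV" by (simp add: \<beta>0_def)
    have agree: "\<forall>p\<in>{1..n-1}. \<beta>0 p = b p y" by (simp add: \<beta>0_def)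
    (* At each sample point exactly one summand survives. *)
    have Eiff: "y \<in> E \<beta> \<longleftrightarrow> \<beta> = \<beta>0" if "\<beta> \<in> {1..n-1} \<rightarrow>\<^sub>E UNIV" for \<beta>
    proof
      assume "y \<in> E \<beta>"
      then show "\<beta> = \<beta>0" by (intro PiE_ext[OF that \<beta>0]) (auto simp: E_def \<beta>0_def)
    qed (use y in \<open>auto simp: E_def \<beta>0_def\<close>)
    have "(\<Sum>\<beta>\<in>{1..n-1} \<rightarrow>\<^sub>E UNIV. indicator (E \<beta>) y *\<^sub>R F \<beta> y) =
        (\<Sum>\<beta>\<in>{1..n-1} \<rightarrow>\<^sub>E UNIV. if \<beta> = \<beta>0 then F \<beta> y else 0)"
      by (intro sum.cong refl) (auto simp: indicator_def Eiff)
    also have "\<dots> = F \<beta>0 y"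
      using \<beta>0 by (simp add: finite_PiE)
    also have "\<dots> = (\<Prod>i\<leftarrow>us. random_composition_tensor n b g i y) *
        cnj (\<Prod>k\<leftarrow>vs. random_composition_tensor n b g k y)"
      unfolding F_def random_composition_tensor_def composition_tensor_cong[OF agree] ..
    finally show "(\<Sum>\<beta>\<in>{1..n-1} \<rightarrow>\<^sub>E UNIV. indicator (E \<beta>) y *\<^sub>R F \<beta> y) =
        (\<Prod>i\<leftarrow>us. random_composition_tensor n b g i y) *
        cnj (\<Prod>k\<leftarrow>vs. random_composition_tensor n b g k y)" .
  qed (simp add: c_def)
qed

text \<open>
  The mean of a product over independent Bernoulli variables of parameter \<open>1/chi\<close> is the product of
  the means.
\<close>

lemma sum_bernoulli_patterns:
  fixes f :: "nat \<Rightarrow> bool \<Rightarrow> complex"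
  assumes "chi \<ge> 1"
  shows "(\<Sum>\<beta>\<in>{1..n-1} \<rightarrow>\<^sub>E UNIV. (\<Prod>p=1..n-1. of_real (pmf (bernoulli_pmf (1 / real chi)) (\<beta> p))) *
      (\<Prod>p=1..n-1. f p (\<beta> p))) =
    (\<Prod>p=1..n-1. of_real (1 / real chi) * f p True + of_real (1 - 1 / real chi) * f p False)"
proof -
  have "(\<Sum>\<beta>\<in>{1..n-1} \<rightarrow>\<^sub>E UNIV. (\<Prod>p=1..n-1. of_real (pmf (bernoulli_pmf (1 / real chi)) (\<beta> p))) *
      (\<Prod>p=1..n-1. f p (\<beta> p))) =
      (\<Sum>\<beta>\<in>{1..n-1} \<rightarrow>\<^sub>E UNIV. \<Prod>p=1..n-1. of_real (pmf (bernoulli_pmf (1 / real chi)) (\<beta> p)) * f p (\<beta> p))"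
    by (simp only: prod.distrib)
  also have "\<dots> = (\<Prod>p=1..n-1. \<Sum>x\<in>UNIV. of_real (pmf (bernoulli_pmf (1 / real chi)) x) * f p x)"
    by (rule prod_sum_PiE[symmetric]) auto
  finally show ?thesis
    using assms by (simp add: UNIV_bool add.commute)
qed

text \<open>
  Without conjugated factors, already the factor of the first part vanishes.
\<close>

lemma random_composition_holomorphic_moment:
  assumes N: "random_composition_gaussians N d chi n b g" and n: "n \<ge> 2"
    and us: "set (u # us) \<subseteq> multi_indices d n" "length us \<le> 3"
  shows "has_bochner_integral N (\<lambda>y. \<Prod>i\<leftarrow>u # us. random_composition_tensor n b g i y) 0"
proof -
  have "wick_moment 1 (multi_indices d (part_size n \<beta> 1)) (map (segment n \<beta> 1) (u # us)) (map (segment n \<beta> 1) []) = 0" for \<beta>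
    using us(1) n num_parts_pos[of n \<beta>] segment_in_multi_indices[of n u d 1 \<beta>]
    by (intro wick_moment_eq_0[where r = "segment n \<beta> 1 u"] finite_multi_indices) auto
  then have "(\<Prod>q=1..num_parts n \<beta>. wick_moment 1 (multi_indices d (part_size n \<beta> q))
       (map (segment n \<beta> q) (u # us)) (map (segment n \<beta> q) [])) = 0" for \<beta>
    using num_parts_pos[of n \<beta>] by (intro prod_zero bexI[of _ 1]) auto
  then show ?thesis
    using random_composition_moment[OF N n us(1), of "[]"] us(2) by simp
qed

lemma random_composition_second_moment:
  assumes N: "random_composition_gaussians N d chi n b g" and n: "n \<ge> 2" and chi: "chi \<ge> 1"
    and i: "i \<in> multi_indices d n" and k: "k \<in> multi_indices d n"
  shows "has_bochner_integral N
    (\<lambda>y. random_composition_tensor n b g i y * cnj (random_composition_tensor n b g k y)) (of_bool (i = k))"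
proof -
  let ?w = "\<lambda>\<beta>. \<Prod>p=1..n-1. complex_of_real (pmf (bernoulli_pmf (1 / real chi)) (\<beta> p))"
  have n1: "n \<ge> 1" using n by simp
  have W: "(\<Prod>q=1..num_parts n \<beta>. wick_moment 1 (multi_indices d (part_size n \<beta> q))
       (map (segment n \<beta> q) [i]) (map (segment n \<beta> q) [k])) = of_bool (i = k)" for \<beta>
  proof -
    have "(\<Prod>q=1..num_parts n \<beta>. wick_moment 1 (multi_indices d (part_size n \<beta> q))
        (map (segment n \<beta> q) [i]) (map (segment n \<beta> q) [k])) =
        (\<Prod>q=1..num_parts n \<beta>. \<Prod>p\<in>part_positions n \<beta> q. of_bool (i p = k p))"
    proof (rule prod.cong[OF refl])
      fix q assume q: "q \<in> {1..num_parts n \<beta>}"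
      show "wick_moment 1 (multi_indices d (part_size n \<beta> q))
        (map (segment n \<beta> q) [i]) (map (segment n \<beta> q) [k]) = (\<Prod>p\<in>part_positions n \<beta> q. of_bool (i p = k p))"
        using wick_moment_1_1[OF finite_multi_indices segment_in_multi_indices[OF n1 i q] segment_in_multi_indices[OF n1 k q], of 1]
        by (simp add: segment_eq_iff prod_of_bool)
    qed
    also have "\<dots> = of_bool (\<forall>p\<in>{1..n}. i p = k p)"
      by (simp only: prod_over_parts[OF n1] prod_of_bool[OF finite_atLeastAtMost])
    also have "(\<forall>p\<in>{1..n}. i p = k p) \<longleftrightarrow> i = k"
      using i k PiE_ext[of i "{1..n}" "\<lambda>_. {1..d}" k] by (auto simp: multi_indices_def)
    finally show ?thesis .
  qed
  have "(\<Sum>\<beta>\<in>{1..n-1} \<rightarrow>\<^sub>E UNIV. ?w \<beta> * of_bool (i = k)) = of_bool (i = k)"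
    using sum_bernoulli_patterns[OF chi, of n "\<lambda>_ _. 1"] by (simp flip: sum_distrib_right)
  then show ?thesis
    using random_composition_moment[OF N n, of "[i]" "[k]"] i k by (simp only: W) simp
qed

text \<open>
  Given the composition \<open>\<beta>\<close>, the moment is a sum over the sequences of matchings compatible with
  \<open>\<beta>\<close>. A break occurs with probability \<open>1/chi\<close>, so the probability of being compatible at \<open>p\<close> is
  \<open>1\<close> for equal and \<open>1/chi\<close> for different neighbours: the entry of the transfer matrix.
\<close>

lemma random_composition_fourth_moment:
  assumes N: "random_composition_gaussians N d chi n b g" and n: "n \<ge> 2" and chi: "chi \<ge> 1"
    and i: "i \<in> multi_indices d n" and j: "j \<in> multi_indices d n"
    and k: "k \<in> multi_indices d n" and l: "l \<in> multi_indices d n"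
  shows "has_bochner_integral N
    (\<lambda>y. random_composition_tensor n b g i y * random_composition_tensor n b g j y *
      cnj (random_composition_tensor n b g k y * random_composition_tensor n b g l y))
    (\<Sum>\<alpha> \<in> {1..n} \<rightarrow>\<^sub>E {1..2}.
       (\<Prod>p=1..n. wick_tensor (i p) (j p) (k p) (l p) (\<alpha> p)) *
       (\<Prod>p=1..n-1. transfer_matrix chi (\<alpha> p) (\<alpha> (p + 1))))"
proof -
  let ?w = "\<lambda>\<beta>. \<Prod>p=1..n-1. complex_of_real (pmf (bernoulli_pmf (1 / real chi)) (\<beta> p))"
  let ?P = "\<lambda>p s. wick_tensor (i p) (j p) (k p) (l p) s"
  let ?Q = "\<lambda>a. \<Prod>p=1..n. ?P p (a p)"
  let ?A = "{1..n} \<rightarrow>\<^sub>E {1..2::nat}" and ?B = "{1..n-1} \<rightarrow>\<^sub>E (UNIV :: bool set)"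
  let ?ok = "\<lambda>(a :: nat \<Rightarrow> nat) \<beta>. \<Prod>p=1..n-1. of_bool (\<beta> p \<or> a p = a (p + 1)) :: complex"
  let ?M = "\<lambda>\<beta>. \<Prod>q=1..num_parts n \<beta>. wick_moment 1 (multi_indices d (part_size n \<beta> q))
       (map (segment n \<beta> q) [i, j]) (map (segment n \<beta> q) [k, l])"
  have n1: "n \<ge> 1" using n by simp
  have W: "?M \<beta> = (\<Sum>a\<in>?A. ?Q a * ?ok a \<beta>)" for \<beta>
  proof -
    have "?M \<beta> = (\<Prod>q=1..num_parts n \<beta>. \<Sum>s=1..2. \<Prod>p\<in>part_positions n \<beta> q. ?P p s)"
    proof (rule prod.cong[OF refl])
      fix q assume q: "q \<in> {1..num_parts n \<beta>}"
      show "wick_moment 1 (multi_indices d (part_size n \<beta> q))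
        (map (segment n \<beta> q) [i, j]) (map (segment n \<beta> q) [k, l]) = (\<Sum>s=1..2. \<Prod>p\<in>part_positions n \<beta> q. ?P p s)"
        using wick_moment_2_2[OF finite_multi_indices segment_in_multi_indices[OF n1 i q]
            segment_in_multi_indices[OF n1 j q] segment_in_multi_indices[OF n1 k q]
            segment_in_multi_indices[OF n1 l q], of 1]
        by (simp only: list.map pairing_segment wick_tensor_eq_pairing of_real_1 power_one mult_1)
    qed
    also have "\<dots> = (\<Sum>a\<in>?A. ?Q a * ?ok a \<beta>)"
      by (rule sum_colourings_of_parts[OF n1]) simp
    finally show ?thesis .
  qed
  have "(\<Sum>\<beta>\<in>?B. ?w \<beta> * ?M \<beta>) = (\<Sum>a\<in>?A. \<Sum>\<beta>\<in>?B. ?Q a * (?w \<beta> * ?ok a \<beta>))"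
    unfolding W sum_distrib_left by (subst sum.swap) (simp only: mult_ac)
  also have "\<dots> = (\<Sum>a\<in>?A. ?Q a * (\<Sum>\<beta>\<in>?B. ?w \<beta> * ?ok a \<beta>))"
    by (simp only: sum_distrib_left)
  also have "\<dots> = (\<Sum>a\<in>?A. ?Q a * (\<Prod>p=1..n-1. transfer_matrix chi (a p) (a (p + 1))))"
  proof (intro sum.cong refl arg_cong2[where f = "(*)"])
    fix a :: "nat \<Rightarrow> nat"
    have "(\<Sum>\<beta>\<in>?B. ?w \<beta> * ?ok a \<beta>) = (\<Prod>p=1..n-1.
        of_real (1 / real chi) * of_bool (True \<or> a p = a (p + 1)) +
        of_real (1 - 1 / real chi) * of_bool (False \<or> a p = a (p + 1)))"
      by (rule sum_bernoulli_patterns[OF chi])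
    also have "\<dots> = (\<Prod>p=1..n-1. transfer_matrix chi (a p) (a (p + 1)))"
      by (intro prod.cong refl) (simp add: transfer_matrix_def)
    finally show "(\<Sum>\<beta>\<in>?B. ?w \<beta> * ?ok a \<beta>) = (\<Prod>p=1..n-1. transfer_matrix chi (a p) (a (p + 1)))" .
  qed
  finally have "(\<Sum>\<beta>\<in>?B. ?w \<beta> * ?M \<beta>) =
    (\<Sum>a\<in>?A. ?Q a * (\<Prod>p=1..n-1. transfer_matrix chi (a p) (a (p + 1))))" .
  moreover have "has_bochner_integral N
    (\<lambda>y. random_composition_tensor n b g i y * random_composition_tensor n b g j y *
      cnj (random_composition_tensor n b g k y * random_composition_tensor n b g l y))
    (\<Sum>\<beta>\<in>?B. ?w \<beta> * ?M \<beta>)"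
    using random_composition_moment[OF N n, of "[i, j]" "[k, l]"] i j k l by simp
  ultimately show ?thesis by (simp only:)
qed

section \<open>Variance of a quadratic form\<close>

lemma base_digits_inject:
  fixes a b :: nat
  assumes "a < d ^ n" "b < d ^ n" "\<forall>p<n. a div d ^ p mod d = b div d ^ p mod d"
  shows "a = b"
  using assms
proof (induction n arbitrary: a b)
  case (Suc n)
  have "a div d = b div d"
  proof (rule Suc.IH)
    show "a div d < d ^ n" "b div d < d ^ n"
      using Suc.prems by (auto simp: less_mult_imp_div_less mult.commute)
    show "\<forall>p<n. a div d div d ^ p mod d = b div d div d ^ p mod d"
    proof (intro allI impI)
      fix p assume "p < n"
      then have "a div d ^ Suc p mod d = b div d ^ Suc p mod d" using Suc.prems(3) by auto
      then show "a div d div d ^ p mod d = b div d div d ^ p mod d"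
        by (simp add: div_mult2_eq)
    qed
  qed
  moreover have "a mod d = b mod d" using Suc.prems(3)[rule_format, of 0] by simp
  ultimately show ?case by (metis div_mult_mod_eq)
qed simp

lemma nth_multi_index_mem:
  "d \<ge> 1 \<Longrightarrow> nth_multi_index d n a \<in> multi_indices d n"
  by (auto simp: nth_multi_index_def multi_indices_def Suc_le_eq)

lemma nth_multi_index_inject:
  assumes "a < d ^ n" "b < d ^ n" "\<forall>p\<in>{1..n}. nth_multi_index d n a p = nth_multi_index d n b p"
  shows "a = b"
proof (rule base_digits_inject[OF assms(1,2)], intro allI impI)
  fix p assume "p < n"
  then have "nth_multi_index d n a (Suc p) = nth_multi_index d n b (Suc p)"
    using assms(3) by auto
  then show "a div d ^ p mod d = b div d ^ p mod d"
    using \<open>p < n\<close> by (simp add: nth_multi_index_def)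
qed

lemma quad_form_flatten:
  assumes "A \<in> carrier_mat (d ^ n) (d ^ n)"
  shows "quad_form A (flatten d n w) = (\<Sum>a<d ^ n. \<Sum>b<d ^ n.
    A $$ (a, b) * (w (nth_multi_index d n b) * cnj (w (nth_multi_index d n a))))"
  using assms
  by (simp add: quad_form_def flatten_def scalar_prod_def lessThan_atLeast0 sum_distrib_right mult.assoc)

text \<open>
  Schur's test for a zero-one kernel with at most one non-zero entry in every row and column. It is
  applied to the relation between index pairs that a sequence of matchings defines.
\<close>

lemma schur_test_partial_matching:
  fixes X :: "'a \<Rightarrow> real" and Y :: "'b \<Rightarrow> real"
  assumes fin: "finite P" "finite Q"
    and R: "\<And>x y y'. x \<in> P \<Longrightarrow> y \<in> Q \<Longrightarrow> y' \<in> Q \<Longrightarrow> R x y \<Longrightarrow> R x y' \<Longrightarrow> y = y'"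
      "\<And>x x' y. x \<in> P \<Longrightarrow> x' \<in> P \<Longrightarrow> y \<in> Q \<Longrightarrow> R x y \<Longrightarrow> R x' y \<Longrightarrow> x = x'"
  shows "(\<Sum>x\<in>P. \<Sum>y\<in>Q. of_bool (R x y) * (X x * Y y)) \<le> sqrt (\<Sum>x\<in>P. (X x)\<^sup>2) * sqrt (\<Sum>y\<in>Q. (Y y)\<^sup>2)"
proof -
  have sub: "(\<Sum>z\<in>S. of_bool (T z) * c) \<le> c" if "finite S" "c \<ge> 0"
    "\<And>z z'. z \<in> S \<Longrightarrow> z' \<in> S \<Longrightarrow> T z \<Longrightarrow> T z' \<Longrightarrow> z = z'" for S :: "'c set" and T and c :: real
  proof (cases "\<exists>z\<in>S. T z")
    case True
    then obtain z where z: "z \<in> S" "T z" by blast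
    have "(\<Sum>z\<in>S. of_bool (T z) * c) = (\<Sum>z'\<in>S. if z' = z then c else 0)"
      using that(3) z by (intro sum.cong) auto
    also have "\<dots> = c" using that(1) z by simp
    finally show ?thesis by simp
  next
    case False
    then have "(\<Sum>z\<in>S. of_bool (T z) * c) = 0" by (intro sum.neutral) auto
    then show ?thesis using that(2) by simp
  qed
  let ?S = "P \<times> Q"
  let ?f = "\<lambda>(x, y). of_bool (R x y) * X x" and ?g = "\<lambda>(x, y). of_bool (R x y) * Y y"
  have "(\<Sum>x\<in>P. \<Sum>y\<in>Q. of_bool (R x y) * (X x * Y y)) = (\<Sum>z\<in>?S. ?f z * ?g z)"
    by (simp add: sum.cartesian_product case_prod_unfold) (intro sum.cong; auto)
  also have "\<dots> \<le> sqrt ((\<Sum>z\<in>?S. (?f z)\<^sup>2) * (\<Sum>z\<in>?S. (?g z)\<^sup>2))"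
    using Cauchy_Schwarz_ineq_sum[of ?f ?g ?S] by (intro real_le_rsqrt)
  also have "\<dots> = sqrt (\<Sum>z\<in>?S. (?f z)\<^sup>2) * sqrt (\<Sum>z\<in>?S. (?g z)\<^sup>2)"
    by (rule real_sqrt_mult)
  also have "\<dots> \<le> sqrt (\<Sum>x\<in>P. (X x)\<^sup>2) * sqrt (\<Sum>y\<in>Q. (Y y)\<^sup>2)"
  proof (intro mult_mono real_sqrt_le_mono)
    have "(\<Sum>z\<in>?S. (?f z)\<^sup>2) = (\<Sum>x\<in>P. \<Sum>y\<in>Q. of_bool (R x y) * (X x)\<^sup>2)"
      by (simp add: sum.cartesian_product case_prod_unfold power_mult_distrib) (intro sum.cong; auto)
    also have "\<dots> \<le> (\<Sum>x\<in>P. (X x)\<^sup>2)"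
      using R(1) by (intro sum_mono sub fin) auto
    finally show "(\<Sum>z\<in>?S. (?f z)\<^sup>2) \<le> (\<Sum>x\<in>P. (X x)\<^sup>2)" .
    have "(\<Sum>z\<in>?S. (?g z)\<^sup>2) = (\<Sum>x\<in>P. \<Sum>y\<in>Q. of_bool (R x y) * (Y y)\<^sup>2)"
      by (simp add: sum.cartesian_product case_prod_unfold power_mult_distrib) (intro sum.cong; auto)
    also have "\<dots> = (\<Sum>y\<in>Q. \<Sum>x\<in>P. of_bool (R x y) * (Y y)\<^sup>2)"
      by (rule sum.swap)
    also have "\<dots> \<le> (\<Sum>y\<in>Q. (Y y)\<^sup>2)"
      using R(2) by (intro sum_mono sub fin) auto
    finally show "(\<Sum>z\<in>?S. (?g z)\<^sup>2) \<le> (\<Sum>y\<in>Q. (Y y)\<^sup>2)" .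
  qed (auto intro!: sum_nonneg)
  finally show ?thesis .
qed

lemma sum_PiE_insert:
  fixes F :: "('i \<Rightarrow> 'c) \<Rightarrow> 'b::comm_monoid_add"
  assumes "k \<notin> I"
  shows "(\<Sum>\<alpha>\<in>PiE (insert k I) S. F \<alpha>) = (\<Sum>\<beta>\<in>PiE I S. \<Sum>x\<in>S k. F (\<beta>(k := x)))"
proof -
  have "(\<Sum>\<alpha>\<in>PiE (insert k I) S. F \<alpha>) = (\<Sum>z\<in>S k \<times> PiE I S. F ((\<lambda>(y, g). g(k := y)) z))"
    unfolding PiE_insert_eq using inj_combinator[OF assms, of S] by (subst sum.reindex) auto
  also have "\<dots> = (\<Sum>x\<in>S k. \<Sum>\<beta>\<in>PiE I S. F (\<beta>(k := x)))"
    by (simp add: sum.cartesian_product case_prod_unfold)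
  also have "\<dots> = (\<Sum>\<beta>\<in>PiE I S. \<Sum>x\<in>S k. F (\<beta>(k := x)))"
    by (rule sum.swap)
  finally show ?thesis .
qed

definition transfer_weight :: "nat \<Rightarrow> nat \<Rightarrow> (nat \<Rightarrow> nat) \<Rightarrow> real" where
  "transfer_weight chi n \<alpha> = (\<Prod>p=1..n-1. if \<alpha> p = \<alpha> (p + 1) then 1 else 1 / real chi)"

lemma prod_transfer_matrix:
  "(\<Prod>p=1..n-1. transfer_matrix chi (\<alpha> p) (\<alpha> (p + 1))) = of_real (transfer_weight chi n \<alpha>)"
  unfolding transfer_weight_def of_real_prod
  by (intro prod.cong) (auto simp: transfer_matrix_def)

text \<open>
  The sum over the last matching gives \<open>1 + 1/chi\<close>, whatever the one before it is; the remaining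
  first matching has two values.
\<close>

lemma sum_transfer_weight:
  assumes "n \<ge> 1"
  shows "(\<Sum>\<alpha>\<in>{1..n} \<rightarrow>\<^sub>E {1..2}. transfer_weight chi n \<alpha>) = 2 * (1 + 1 / real chi) ^ (n - 1)"
  using assms
proof (induction n rule: nat_induct_at_least)
  case base
  show ?case
    by (simp add: transfer_weight_def card_PiE)
next
  case (Suc n)
  have ins: "{1..Suc n} = insert (Suc n) {1..n}" by auto
  have "(\<Sum>\<alpha>\<in>{1..Suc n} \<rightarrow>\<^sub>E {1..2}. transfer_weight chi (Suc n) \<alpha>) =
      (\<Sum>\<beta>\<in>{1..n} \<rightarrow>\<^sub>E {1..2}. \<Sum>x=1..2. transfer_weight chi (Suc n) (\<beta>(Suc n := x)))"
    unfolding ins by (rule sum_PiE_insert) simp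
  also have "\<dots> = (\<Sum>\<beta>\<in>{1..n} \<rightarrow>\<^sub>E {1..2}. transfer_weight chi n \<beta> * (1 + 1 / real chi))"
  proof (rule sum.cong[OF refl])
    fix \<beta> assume \<beta>: "\<beta> \<in> {1..n} \<rightarrow>\<^sub>E {1..2::nat}"
    have n: "{1..Suc n - 1} = insert n {1..n-1}" using Suc.hyps by auto
    have w: "transfer_weight chi (Suc n) (\<beta>(Suc n := x)) =
        transfer_weight chi n \<beta> * (if \<beta> n = x then 1 else 1 / real chi)" for x
    proof -
      have "(\<Prod>p=1..n-1. if (\<beta>(Suc n := x)) p = (\<beta>(Suc n := x)) (p + 1) then 1 else 1 / real chi) =
          transfer_weight chi n \<beta>"
        unfolding transfer_weight_def by (intro prod.cong) auto
      then show ?thesis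
        unfolding transfer_weight_def[of chi "Suc n"] n using Suc.hyps by simp
    qed
    have "\<beta> n \<in> {1..2}" using \<beta> Suc.hyps by auto
    then have "\<beta> n = 1 \<or> \<beta> n = 2" by auto
    then show "(\<Sum>x=1..2. transfer_weight chi (Suc n) (\<beta>(Suc n := x))) =
        transfer_weight chi n \<beta> * (1 + 1 / real chi)"
      unfolding sum_1_to_2 w by (elim disjE) (simp_all add: algebra_simps)
  qed
  also have "\<dots> = 2 * (1 + 1 / real chi) ^ (n - 1) * (1 + 1 / real chi)"
    by (simp only: sum_distrib_right[symmetric] Suc.IH)
  also have "\<dots> = 2 * (1 + 1 / real chi) ^ (Suc n - 1)"
    using Suc.hyps by (cases n) simp_all
  finally show ?case .
qed

text \<open>
  The coefficient of the sequence of matchings \<open>\<alpha>\<close> in the expansion of \<open>E|\<omega>\<^sup>* A \<omega>|\<^sup>2\<close>. If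
  \<open>S\<close> is the set of positions with \<open>\<alpha> p = 1\<close>, it is the squared Frobenius norm of the partial trace
  of \<open>A\<close> over the tensor factors in \<open>S\<close>.
\<close>

definition wick_contraction ::
    "nat \<Rightarrow> nat \<Rightarrow> complex mat \<Rightarrow> (nat \<Rightarrow> nat) \<Rightarrow> complex" where
  "wick_contraction d n A \<alpha> = (let f = nth_multi_index d n in
     \<Sum>a<d ^ n. \<Sum>b<d ^ n. \<Sum>c<d ^ n. \<Sum>e<d ^ n. A $$ (a, b) * cnj (A $$ (c, e)) *
       (\<Prod>p=1..n. wick_tensor (f b p) (f c p) (f a p) (f e p) (\<alpha> p)))"

lemma prod_wick_tensor:
  fixes n :: nat
  shows "(\<Prod>p=1..n. wick_tensor (i p) (j p) (k p) (l p) (\<alpha> p)) =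
    of_bool (\<forall>p\<in>{1..n}. if \<alpha> p = 1 then i p = k p \<and> j p = l p else i p = l p \<and> j p = k p)"
proof -
  have "(\<Prod>p=1..n. wick_tensor (i p) (j p) (k p) (l p) (\<alpha> p)) =
      (\<Prod>p=1..n. of_bool (if \<alpha> p = 1 then i p = k p \<and> j p = l p else i p = l p \<and> j p = k p))"
    by (intro prod.cong refl) (simp only: wick_tensor_def of_bool_conj if_distrib[of of_bool])
  also have "\<dots> = of_bool (\<forall>p\<in>{1..n}. if \<alpha> p = 1 then i p = k p \<and> j p = l p else i p = l p \<and> j p = k p)"
    by (rule prod_of_bool) simp
  finally show ?thesis .
qed

text \<open>
  Here all tensor factors are traced out.
\<close>

lemma wick_contraction_trace:
  assumes "\<forall>p\<in>{1..n}. \<alpha> p = 1"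
  shows "wick_contraction d n A \<alpha> = of_real ((cmod (\<Sum>a<d ^ n. A $$ (a, a)))\<^sup>2)"
proof -
  let ?D = "d ^ n" and ?f = "nth_multi_index d n"
  have "(\<forall>p\<in>{1..n}. if \<alpha> p = 1 then ?f b p = ?f a p \<and> ?f c p = ?f e p
      else ?f b p = ?f e p \<and> ?f c p = ?f a p) \<longleftrightarrow> a = b \<and> c = e"
    if "a < ?D" "b < ?D" "c < ?D" "e < ?D" for a b c e
    using assms nth_multi_index_inject[of b d n a] nth_multi_index_inject[of c d n e] that by auto
  then have "wick_contraction d n A \<alpha> = (\<Sum>a<?D. \<Sum>b<?D. \<Sum>c<?D. \<Sum>e<?D.
      of_bool (c = e) * (of_bool (a = b) * (A $$ (a, b) * cnj (A $$ (c, e)))))"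
    unfolding wick_contraction_def Let_def prod_wick_tensor by (intro sum.cong refl) auto
  also have "\<dots> = (\<Sum>a<?D. \<Sum>b<?D. of_bool (a = b) * (\<Sum>c<?D. A $$ (a, b) * cnj (A $$ (c, c))))"
    by (simp only: sum_of_bool_eq_mult[OF finite_lessThan] if_True sum_distrib_left cong: sum.cong)
  also have "\<dots> = (\<Sum>a<?D. \<Sum>c<?D. A $$ (a, a) * cnj (A $$ (c, c)))"
    by (simp only: sum_of_bool_eq_mult[OF finite_lessThan] if_True cong: sum.cong)
  also have "\<dots> = (\<Sum>a<?D. A $$ (a, a)) * cnj (\<Sum>c<?D. A $$ (c, c))"
    by (simp only: sum_product cnj_sum)
  finally show ?thesis by (simp only: complex_norm_square)
qed

text \<open>
  Here no tensor factor is traced out.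
\<close>

lemma wick_contraction_frobenius:
  assumes "\<forall>p\<in>{1..n}. \<alpha> p = 2" and A: "A \<in> carrier_mat (d ^ n) (d ^ n)"
  shows "wick_contraction d n A \<alpha> = of_real ((frobenius_norm A)\<^sup>2)"
proof -
  let ?D = "d ^ n" and ?f = "nth_multi_index d n"
  have "(\<forall>p\<in>{1..n}. if \<alpha> p = 1 then ?f b p = ?f a p \<and> ?f c p = ?f e p
      else ?f b p = ?f e p \<and> ?f c p = ?f a p) \<longleftrightarrow> b = e \<and> a = c"
    if "a < ?D" "b < ?D" "c < ?D" "e < ?D" for a b c e
    using assms(1) nth_multi_index_inject[of b d n e] nth_multi_index_inject[of c d n a] that by auto
  then have "wick_contraction d n A \<alpha> = (\<Sum>a<?D. \<Sum>b<?D. \<Sum>c<?D. \<Sum>e<?D.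
      of_bool (b = e) * (of_bool (a = c) * (A $$ (a, b) * cnj (A $$ (c, e)))))"
    unfolding wick_contraction_def Let_def prod_wick_tensor by (intro sum.cong refl) simp
  also have "\<dots> = (\<Sum>a<?D. \<Sum>b<?D. A $$ (a, b) * cnj (A $$ (a, b)))"
    by (simp only: sum_of_bool_eq_mult[OF finite_lessThan] if_True cong: sum.cong)
  also have "\<dots> = of_real (\<Sum>a<?D. \<Sum>b<?D. (cmod (A $$ (a, b)))\<^sup>2)"
    by (simp only: of_real_sum complex_norm_square)
  also have "(\<Sum>a<?D. \<Sum>b<?D. (cmod (A $$ (a, b)))\<^sup>2) = (frobenius_norm A)\<^sup>2"
  proof -
    have "0 \<le> (\<Sum>a<?D. \<Sum>b<?D. (cmod (A $$ (a, b)))\<^sup>2)" by (intro sum_nonneg) auto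
    then show ?thesis using A by (simp add: frobenius_norm_def)
  qed
  finally show ?thesis .
qed

lemma sum_Times: "(\<Sum>z\<in>A \<times> B. g z) = (\<Sum>x\<in>A. \<Sum>y\<in>B. g (x, y))"
  for g :: "'a \<times> 'b \<Rightarrow> 'c::comm_monoid_add"
  by (simp add: sum.cartesian_product)

text \<open>
  The matchings relate the pair \<open>(a, e)\<close> to \<open>(b, c)\<close> by exchanging the coordinates of \<open>a\<close> and
  \<open>e\<close> at the positions with \<open>\<alpha> p \<noteq> 1\<close>, which is an injective relation. For \<open>A\<close> decomposed into
  rank-one matrices, Schur's test bounds the contribution of the summands \<open>r\<close> and \<open>s\<close> by
  \<open>|w r| |v s| |v r| |w s| = |w r| |w s|\<close>, and these bounds sum to \<open>(\<Sum>\<^sub>r |w r|)\<^sup>2\<close>. The pair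
  \<open>(a, e)\<close> consists of a row index of the first and a column index of the second copy of \<open>A\<close>; this is
  why it meets one vector \<open>w\<close> and one unit vector \<open>v\<close>, as does \<open>(b, c)\<close>.
\<close>

lemma norm_wick_contraction_le:
  assumes A: "A \<in> carrier_mat (d ^ n) (d ^ n)"
  shows "cmod (wick_contraction d n A \<alpha>) \<le> (nuclear_norm A)\<^sup>2"
proof -
  let ?D = "d ^ n" and ?f = "nth_multi_index d n"
  obtain w v :: "nat \<Rightarrow> nat \<Rightarrow> complex" where
    dec: "\<And>a b. a < ?D \<Longrightarrow> b < ?D \<Longrightarrow> A $$ (a, b) = (\<Sum>r<?D. w r a * cnj (v r b))"
    and v: "\<And>r. r < ?D \<Longrightarrow> (\<Sum>a<?D. (cmod (v r a))\<^sup>2) = 1"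
    and w: "(\<Sum>r<?D. sqrt (\<Sum>a<?D. (cmod (w r a))\<^sup>2)) = nuclear_norm A"
    using rank_one_decomposition[OF A] by blast
  define R where "R = (\<lambda>(a, e) (b, c). \<forall>p\<in>{1..n}. if \<alpha> p = 1 then ?f b p = ?f a p \<and> ?f c p = ?f e p
      else ?f b p = ?f e p \<and> ?f c p = ?f a p)"
  let ?S = "{..<?D} \<times> {..<?D}"
  let ?x = "\<lambda>r s (a, e). w r a * v s e" and ?y = "\<lambda>r s (b, c). cnj (v r b) * cnj (w s c)"
  have norm_pair: "(\<Sum>(a, e)\<in>?S. (cmod (g a) * cmod (h e))\<^sup>2) =
      (\<Sum>a<?D. (cmod (g a))\<^sup>2) * (\<Sum>e<?D. (cmod (h e))\<^sup>2)" for g h :: "nat \<Rightarrow> complex"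
    by (simp add: sum_product sum.cartesian_product power_mult_distrib)
  have R_unique: "y = y'" if "x \<in> ?S" "y \<in> ?S" "y' \<in> ?S" "R x y" "R x y'" for x y y'
  proof -
    obtain a e b c b' c' where xy: "x = (a, e)" "y = (b, c)" "y' = (b', c')" by (cases x; cases y; cases y')
    have "?f b p = ?f b' p \<and> ?f c p = ?f c' p" if p: "p \<in> {1..n}" for p
      using \<open>R x y\<close>[unfolded R_def xy split_conv, rule_format, OF p]
        \<open>R x y'\<close>[unfolded R_def xy split_conv, rule_format, OF p]
      by (cases "\<alpha> p = 1") simp_all
    then show ?thesis
      using that(1-3) nth_multi_index_inject[of b d n b'] nth_multi_index_inject[of c d n c'] xy by auto
  qed
  (* Equality of coordinates is symmetric, so uniqueness in one direction gives the other. *)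
  have R_sym: "R (a, e) (b, c) \<longleftrightarrow> R (b, c) (a, e)" for a b c e
    unfolding R_def by (auto split: if_splits)
  have R_unique': "x = x'" if "x \<in> ?S" "x' \<in> ?S" "y \<in> ?S" "R x y" "R x' y" for x x' y
    using R_unique[of y x x'] that R_sym by (metis surj_pair)
  have block: "cmod (\<Sum>x\<in>?S. \<Sum>y\<in>?S. of_bool (R x y) * (?x r s x * ?y r s y)) \<le>
      sqrt (\<Sum>a<?D. (cmod (w r a))\<^sup>2) * sqrt (\<Sum>a<?D. (cmod (w s a))\<^sup>2)" if r: "r < ?D" and s: "s < ?D" for r s
  proof -
    have "cmod (\<Sum>x\<in>?S. \<Sum>y\<in>?S. of_bool (R x y) * (?x r s x * ?y r s y)) \<le>
        (\<Sum>x\<in>?S. \<Sum>y\<in>?S. of_bool (R x y) * (cmod (?x r s x) * cmod (?y r s y)))"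
      by (intro order.trans[OF norm_sum] sum_mono order.trans[OF norm_sum]) (simp add: norm_mult)
    also have "\<dots> \<le> sqrt (\<Sum>x\<in>?S. (cmod (?x r s x))\<^sup>2) * sqrt (\<Sum>y\<in>?S. (cmod (?y r s y))\<^sup>2)"
      using R_unique R_unique' by (intro schur_test_partial_matching) auto
    also have "(\<Sum>x\<in>?S. (cmod (?x r s x))\<^sup>2) = (\<Sum>a<?D. (cmod (w r a))\<^sup>2)"
      using norm_pair[of "w r" "v s"] v[OF s] by (simp add: norm_mult case_prod_unfold)
    also have "(\<Sum>y\<in>?S. (cmod (?y r s y))\<^sup>2) = (\<Sum>a<?D. (cmod (w s a))\<^sup>2)"
      using norm_pair[of "v r" "w s"] v[OF r] by (simp add: norm_mult case_prod_unfold)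
    finally show ?thesis .
  qed
  have "wick_contraction d n A \<alpha> = (\<Sum>a<?D. \<Sum>b<?D. \<Sum>c<?D. \<Sum>e<?D.
      A $$ (a, b) * cnj (A $$ (c, e)) * of_bool (R (a, e) (b, c)))"
    unfolding wick_contraction_def Let_def prod_wick_tensor R_def by simp
  also have "\<dots> = (\<Sum>a<?D. \<Sum>b<?D. \<Sum>c<?D. \<Sum>e<?D. \<Sum>r<?D. \<Sum>s<?D.
      of_bool (R (a, e) (b, c)) * (?x r s (a, e) * ?y r s (b, c)))"
    by (intro sum.cong refl) (simp add: dec sum_product sum_distrib_left mult_ac)
  also have "\<dots> = (\<Sum>a<?D. \<Sum>e<?D. \<Sum>b<?D. \<Sum>c<?D. \<Sum>r<?D. \<Sum>s<?D.
      of_bool (R (a, e) (b, c)) * (?x r s (a, e) * ?y r s (b, c)))"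
  proof (rule sum.cong[OF refl])
    fix a
    let ?t = "\<lambda>b c e. \<Sum>r<?D. \<Sum>s<?D. of_bool (R (a, e) (b, c)) * (?x r s (a, e) * ?y r s (b, c))"
    have "(\<Sum>b<?D. \<Sum>c<?D. \<Sum>e<?D. ?t b c e) = (\<Sum>b<?D. \<Sum>e<?D. \<Sum>c<?D. ?t b c e)"
      by (intro sum.cong refl sum.swap)
    also have "\<dots> = (\<Sum>e<?D. \<Sum>b<?D. \<Sum>c<?D. ?t b c e)"
      by (rule sum.swap)
    finally show "(\<Sum>b<?D. \<Sum>c<?D. \<Sum>e<?D. ?t b c e) = (\<Sum>e<?D. \<Sum>b<?D. \<Sum>c<?D. ?t b c e)" .
  qed
  also have "\<dots> = (\<Sum>x\<in>?S. \<Sum>y\<in>?S. \<Sum>r<?D. \<Sum>s<?D. of_bool (R x y) * (?x r s x * ?y r s y))"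
    by (simp only: sum_Times split_conv)
  also have "\<dots> = (\<Sum>r<?D. \<Sum>s<?D. \<Sum>x\<in>?S. \<Sum>y\<in>?S. of_bool (R x y) * (?x r s x * ?y r s y))"
    by (simp only: sum.swap[of _ "{..<?D}" ?S])
  finally have "cmod (wick_contraction d n A \<alpha>) \<le>
      (\<Sum>r<?D. \<Sum>s<?D. cmod (\<Sum>x\<in>?S. \<Sum>y\<in>?S. of_bool (R x y) * (?x r s x * ?y r s y)))"
    by (simp only:) (intro order.trans[OF norm_sum] sum_mono order.refl norm_sum)
  also have "\<dots> \<le> (\<Sum>r<?D. \<Sum>s<?D. sqrt (\<Sum>a<?D. (cmod (w r a))\<^sup>2) * sqrt (\<Sum>a<?D. (cmod (w s a))\<^sup>2))"
    by (intro sum_mono block) auto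
  also have "\<dots> = (nuclear_norm A)\<^sup>2"
    by (simp only: sum_product[symmetric] w power2_eq_square[of "nuclear_norm A"])
  finally show ?thesis .
qed

text \<open>
  In the expansion of the second absolute moment over sequences of matchings, the constant sequence
  \<open>1\<close> cancels against the squared mean \<open>|tr A|\<^sup>2\<close> and the constant sequence \<open>2\<close> gives the Frobenius
  norm. All other sequences are bounded by their weight times the squared nuclear norm.
\<close>

lemma mps_quad_form_variance:
  assumes G: "random_cores M d chi n G" and d: "d \<ge> 1" and chi: "chi \<ge> 1" and n: "n \<ge> 2"
    and A: "A \<in> carrier_mat (d ^ n) (d ^ n)"
  defines "X \<equiv> (\<lambda>x. quad_form A (flatten d n (\<lambda>i. mps chi n G i x)))"
  shows "integrable M X" "integrable M (\<lambda>x. (cmod (X x))\<^sup>2)"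
    "complex_variance M X \<le> (frobenius_norm A)\<^sup>2 +
       2 * ((1 + 1 / real chi) ^ (n - 1) - 1) * (nuclear_norm A)\<^sup>2"
proof -
  let ?D = "d ^ n" and ?f = "nth_multi_index d n" and ?w = "mps chi n G"
  let ?C = "{1..n} \<rightarrow>\<^sub>E {1..2::nat}"
  let ?T = "transfer_weight chi n" and ?Q = "wick_contraction d n A"
  let ?tr = "\<Sum>a<?D. A $$ (a, a)" and ?N = "nuclear_norm A"
  note f = nth_multi_index_mem[OF d, of n]
  have X: "X x = (\<Sum>a<?D. \<Sum>b<?D. A $$ (a, b) * (?w (?f b) x * cnj (?w (?f a) x)))" for x
    unfolding X_def by (rule quad_form_flatten[OF A])
  have "has_bochner_integral M X (\<Sum>a<?D. \<Sum>b<?D. A $$ (a, b) * of_bool (?f b = ?f a))"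
    unfolding X[abs_def]
    by (intro has_bochner_integral_sum has_bochner_integral_mult_right mps_second_moment[OF G chi n] f)
  also have "(\<Sum>a<?D. \<Sum>b<?D. A $$ (a, b) * of_bool (?f b = ?f a)) = (\<Sum>a<?D. \<Sum>b<?D. of_bool (a = b) * A $$ (a, b))"
  proof (intro sum.cong refl)
    fix a b assume "a \<in> {..<?D}" "b \<in> {..<?D}"
    then show "A $$ (a, b) * of_bool (?f b = ?f a) = of_bool (a = b) * A $$ (a, b)"
      using nth_multi_index_inject[of a d n b] by (auto simp: of_bool_def)
  qed
  also have "\<dots> = ?tr"
    by (simp only: sum_of_bool_eq_mult[OF finite_lessThan] if_True cong: sum.cong)
  finally have EX: "has_bochner_integral M X ?tr" .
  have XX: "X x * cnj (X x) = (\<Sum>a<?D. \<Sum>b<?D. \<Sum>c<?D. \<Sum>e<?D. A $$ (a, b) * cnj (A $$ (c, e)) *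
      (?w (?f b) x * ?w (?f c) x * cnj (?w (?f a) x * ?w (?f e) x)))" for x
  proof -
    have "X x * cnj (X x) = (\<Sum>a<?D. \<Sum>c<?D. \<Sum>b<?D. \<Sum>e<?D. A $$ (a, b) * cnj (A $$ (c, e)) *
      (?w (?f b) x * ?w (?f c) x * cnj (?w (?f a) x * ?w (?f e) x)))"
      unfolding X cnj_sum sum_product by (intro sum.cong refl) (simp add: mult_ac)
    also have "\<dots> = (\<Sum>a<?D. \<Sum>b<?D. \<Sum>c<?D. \<Sum>e<?D. A $$ (a, b) * cnj (A $$ (c, e)) *
      (?w (?f b) x * ?w (?f c) x * cnj (?w (?f a) x * ?w (?f e) x)))"
      by (intro sum.cong refl sum.swap)
    finally show ?thesis .
  qed
  have "has_bochner_integral M (\<lambda>x. X x * cnj (X x)) (\<Sum>a<?D. \<Sum>b<?D. \<Sum>c<?D. \<Sum>e<?D.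
      A $$ (a, b) * cnj (A $$ (c, e)) * (\<Sum>\<alpha>\<in>?C.
        (\<Prod>p=1..n. wick_tensor (?f b p) (?f c p) (?f a p) (?f e p) (\<alpha> p)) *
        (\<Prod>p=1..n-1. transfer_matrix chi (\<alpha> p) (\<alpha> (p + 1)))))"
    unfolding XX
    by (intro has_bochner_integral_sum has_bochner_integral_mult_right mps_fourth_moment[OF G chi n] f)
  also have "(\<Sum>a<?D. \<Sum>b<?D. \<Sum>c<?D. \<Sum>e<?D.
      A $$ (a, b) * cnj (A $$ (c, e)) * (\<Sum>\<alpha>\<in>?C.
        (\<Prod>p=1..n. wick_tensor (?f b p) (?f c p) (?f a p) (?f e p) (\<alpha> p)) *
        (\<Prod>p=1..n-1. transfer_matrix chi (\<alpha> p) (\<alpha> (p + 1))))) =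
      (\<Sum>a<?D. \<Sum>b<?D. \<Sum>c<?D. \<Sum>e<?D. \<Sum>\<alpha>\<in>?C. of_real (?T \<alpha>) *
        (A $$ (a, b) * cnj (A $$ (c, e)) * (\<Prod>p=1..n. wick_tensor (?f b p) (?f c p) (?f a p) (?f e p) (\<alpha> p))))"
    by (simp only: prod_transfer_matrix sum_distrib_left mult_ac)
  also have "\<dots> = (\<Sum>\<alpha>\<in>?C. of_real (?T \<alpha>) * ?Q \<alpha>)"
    unfolding wick_contraction_def Let_def sum_distrib_left
    by (simp only: sum.swap[of _ ?C])
  finally have EXX: "has_bochner_integral M (\<lambda>x. X x * cnj (X x)) (\<Sum>\<alpha>\<in>?C. of_real (?T \<alpha>) * ?Q \<alpha>)" .
  have EX2: "has_bochner_integral M (\<lambda>x. (cmod (X x))\<^sup>2) (Re (\<Sum>\<alpha>\<in>?C. of_real (?T \<alpha>) * ?Q \<alpha>))"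
    using has_bochner_integral_bounded_linear[OF bounded_linear_Re EXX]
    by (simp only: complex_norm_square[symmetric] Re_complex_of_real)
  show "integrable M X" "integrable M (\<lambda>x. (cmod (X x))\<^sup>2)"
    using EX EX2 by (auto intro: integrable.intros)
  (* The two constant sequences of matchings. *)
  define c1 c2 :: "nat \<Rightarrow> nat" where "c1 = (\<lambda>p\<in>{1..n}. 1)" and "c2 = (\<lambda>p\<in>{1..n}. 2)"
  have c: "c1 \<in> ?C" "c2 \<in> ?C" by (auto simp: c1_def c2_def)
  have "c1 1 \<noteq> c2 1" using n by (simp add: c1_def c2_def)
  then have c12: "c1 \<noteq> c2" by auto
  have Tc: "?T c1 = 1" "?T c2 = 1"
    unfolding transfer_weight_def c1_def c2_def by (auto intro!: prod.neutral)
  have Qc: "?Q c1 = of_real ((cmod ?tr)\<^sup>2)" "?Q c2 = of_real ((frobenius_norm A)\<^sup>2)"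
    by (rule wick_contraction_trace, simp add: c1_def) (rule wick_contraction_frobenius[OF _ A], simp add: c2_def)
  have split: "sum F ?C = F c1 + (F c2 + sum F (?C - {c1, c2}))" for F :: "(nat \<Rightarrow> nat) \<Rightarrow> 'c::comm_monoid_add"
  proof -
    have "sum F ?C = F c1 + sum F (?C - {c1})"
      using c by (intro sum.remove) (auto simp: finite_PiE)
    also have "sum F (?C - {c1}) = F c2 + sum F (?C - {c1} - {c2})"
      using c c12 by (intro sum.remove) (auto simp: finite_PiE)
    also have "?C - {c1} - {c2} = ?C - {c1, c2}" by auto
    finally show ?thesis .
  qed
  have "complex_variance M X = Re (\<Sum>\<alpha>\<in>?C. of_real (?T \<alpha>) * ?Q \<alpha>) - (cmod ?tr)\<^sup>2"
    using EX EX2 by (simp only: complex_variance_def has_bochner_integral_integral_eq)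
  also have "\<dots> = (frobenius_norm A)\<^sup>2 + Re (\<Sum>\<alpha>\<in>?C - {c1, c2}. of_real (?T \<alpha>) * ?Q \<alpha>)"
    unfolding split[of "\<lambda>\<alpha>. of_real (?T \<alpha>) * ?Q \<alpha>"] Tc Qc by simp
  also have "Re (\<Sum>\<alpha>\<in>?C - {c1, c2}. of_real (?T \<alpha>) * ?Q \<alpha>) \<le> (\<Sum>\<alpha>\<in>?C - {c1, c2}. ?T \<alpha> * ?N\<^sup>2)"
  proof -
    have "Re (\<Sum>\<alpha>\<in>?C - {c1, c2}. of_real (?T \<alpha>) * ?Q \<alpha>) \<le> cmod (\<Sum>\<alpha>\<in>?C - {c1, c2}. of_real (?T \<alpha>) * ?Q \<alpha>)"
      by (rule complex_Re_le_cmod)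
    also have "\<dots> \<le> (\<Sum>\<alpha>\<in>?C - {c1, c2}. ?T \<alpha> * ?N\<^sup>2)"
    proof (intro order.trans[OF norm_sum] sum_mono)
      fix \<alpha>
      have "?T \<alpha> \<ge> 0" unfolding transfer_weight_def by (auto intro!: prod_nonneg)
      then show "cmod (of_real (?T \<alpha>) * ?Q \<alpha>) \<le> ?T \<alpha> * ?N\<^sup>2"
        using norm_wick_contraction_le[OF A, of \<alpha>] by (simp add: norm_mult mult_left_mono)
    qed
    finally show ?thesis .
  qed
  also have "(\<Sum>\<alpha>\<in>?C - {c1, c2}. ?T \<alpha> * ?N\<^sup>2) = 2 * ((1 + 1 / real chi) ^ (n - 1) - 1) * ?N\<^sup>2"
  proof -
    have "(\<Sum>\<alpha>\<in>?C - {c1, c2}. ?T \<alpha>) = 2 * (1 + 1 / real chi) ^ (n - 1) - 2"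
      using split[of ?T] sum_transfer_weight[of n chi] Tc n by simp
    then have "(\<Sum>\<alpha>\<in>?C - {c1, c2}. ?T \<alpha> * ?N\<^sup>2) = (2 * (1 + 1 / real chi) ^ (n - 1) - 2) * ?N\<^sup>2"
      by (simp only: sum_distrib_right[symmetric])
    then show ?thesis by (simp only: left_diff_distrib right_diff_distrib mult.assoc mult_1_right)
  qed
  finally show "complex_variance M X \<le> (frobenius_norm A)\<^sup>2 +
       2 * ((1 + 1 / real chi) ^ (n - 1) - 1) * ?N\<^sup>2" by simp
qed

section \<open>First four moments and variance of the matrix product state\<close>

theorem theorem4p7:
  fixes M :: "'x measure"
    and d chi n :: nat
    and G :: "nat \<times> nat \<times> nat \<times> nat \<Rightarrow> 'x \<Rightarrow> complex"
  defines "\<omega> \<equiv> mps chi n G"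
  assumes "d \<ge> 1" and "chi \<ge> 1" and "n \<ge> 2"
    and "random_cores M d chi n G"
  shows
    "(\<forall>i\<in>multi_indices d n. \<forall>j\<in>multi_indices d n. \<forall>k\<in>multi_indices d n. \<forall>l\<in>multi_indices d n.
        has_bochner_integral M (\<lambda>x. \<omega> i x * \<omega> j x * cnj (\<omega> k x * \<omega> l x))
          (\<Sum>\<alpha> \<in> {1..n} \<rightarrow>\<^sub>E {1..2}.
             (\<Prod>p=1..n. wick_tensor (i p) (j p) (k p) (l p) (\<alpha> p)) *
             (\<Prod>p=1..n-1. transfer_matrix chi (\<alpha> p) (\<alpha> (p + 1)))))
     \<and>
     ((\<forall>i\<in>multi_indices d n. has_bochner_integral M (\<omega> i) 0) \<and>
      (\<forall>i\<in>multi_indices d n. \<forall>j\<in>multi_indices d n.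
        has_bochner_integral M (\<lambda>x. \<omega> i x * cnj (\<omega> j x)) (of_bool (i = j))) \<and>
      (\<forall>i\<in>multi_indices d n. \<forall>j\<in>multi_indices d n. \<forall>k\<in>multi_indices d n.
        has_bochner_integral M (\<lambda>x. \<omega> i x * \<omega> j x * \<omega> k x) 0) \<and>
      (\<forall>(N :: 'y measure) b g.
        random_composition_gaussians N d chi n b g \<longrightarrow>
        (let h = random_composition_tensor n b g in
          (\<forall>i\<in>multi_indices d n. has_bochner_integral N (h i) 0) \<and>
          (\<forall>i\<in>multi_indices d n. \<forall>j\<in>multi_indices d n.
            has_bochner_integral N (\<lambda>y. h i y * cnj (h j y)) (of_bool (i = j))) \<and>
          (\<forall>i\<in>multi_indices d n. \<forall>j\<in>multi_indices d n. \<forall>k\<in>multi_indices d n.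
            has_bochner_integral N (\<lambda>y. h i y * h j y * h k y) 0) \<and>
          (\<forall>i\<in>multi_indices d n. \<forall>j\<in>multi_indices d n.
           \<forall>k\<in>multi_indices d n. \<forall>l\<in>multi_indices d n.
            has_bochner_integral N (\<lambda>y. h i y * h j y * cnj (h k y * h l y))
              (\<integral>x. \<omega> i x * \<omega> j x * cnj (\<omega> k x * \<omega> l x) \<partial>M)))))
     \<and>
     (\<forall>A \<in> carrier_mat (d ^ n) (d ^ n).
        let X = (\<lambda>x. quad_form A (flatten d n (\<lambda>i. \<omega> i x))) in
          integrable M X \<and> integrable M (\<lambda>x. (cmod (X x))\<^sup>2) \<and>
          complex_variance M X
            \<le> (frobenius_norm A)\<^sup>2 +
              2 * ((1 + 1 / real chi) ^ (n - 1) - 1) * (nuclear_norm A)\<^sup>2)"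
proof -
  note chi = \<open>chi \<ge> 1\<close> and n = \<open>n \<ge> 2\<close> and cores = \<open>random_cores M d chi n G\<close>
  have composition_moments:
    "(\<forall>i\<in>multi_indices d n. has_bochner_integral N (h i) 0) \<and>
     (\<forall>i\<in>multi_indices d n. \<forall>j\<in>multi_indices d n.
       has_bochner_integral N (\<lambda>y. h i y * cnj (h j y)) (of_bool (i = j))) \<and>
     (\<forall>i\<in>multi_indices d n. \<forall>j\<in>multi_indices d n. \<forall>k\<in>multi_indices d n.
       has_bochner_integral N (\<lambda>y. h i y * h j y * h k y) 0) \<and>
     (\<forall>i\<in>multi_indices d n. \<forall>j\<in>multi_indices d n.
      \<forall>k\<in>multi_indices d n. \<forall>l\<in>multi_indices d n.
       has_bochner_integral N (\<lambda>y. h i y * h j y * cnj (h k y * h l y))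
         (\<integral>x. \<omega> i x * \<omega> j x * cnj (\<omega> k x * \<omega> l x) \<partial>M))"
    if N: "random_composition_gaussians N d chi n b g" and h: "h = random_composition_tensor n b g"
    for N :: "'y measure" and b g h
  proof (intro conjI ballI)
    fix i assume i: "i \<in> multi_indices d n"
    show "has_bochner_integral N (h i) 0"
      using random_composition_holomorphic_moment[OF N n, of i "[]"] i by (simp add: h)
    fix j assume j: "j \<in> multi_indices d n"
    show "has_bochner_integral N (\<lambda>y. h i y * cnj (h j y)) (of_bool (i = j))"
      unfolding h by (rule random_composition_second_moment[OF N n chi i j])
    fix k assume k: "k \<in> multi_indices d n"
    show "has_bochner_integral N (\<lambda>y. h i y * h j y * h k y) 0"
      using random_composition_holomorphic_moment[OF N n, of i "[j, k]"] i j k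
      by (simp add: h mult.assoc)
    fix l assume l: "l \<in> multi_indices d n"
    show "has_bochner_integral N (\<lambda>y. h i y * h j y * cnj (h k y * h l y))
        (\<integral>x. \<omega> i x * \<omega> j x * cnj (\<omega> k x * \<omega> l x) \<partial>M)"
      using random_composition_fourth_moment[OF N n chi i j k l]
      by (simp only: h \<omega>_def has_bochner_integral_integral_eq[OF mps_fourth_moment[OF cores chi n i j k l]])
  qed
  show ?thesis (is "?fourth \<and> (?first \<and> ?second \<and> ?third \<and> ?composition) \<and> ?variance")
  proof (intro conjI)
    show ?fourth
      unfolding \<omega>_def using mps_fourth_moment[OF cores chi n] by (intro ballI)
    show ?first
      unfolding \<omega>_def using mps_first_moment[OF cores chi n] by (intro ballI)
    show ?second
      unfolding \<omega>_def using mps_second_moment[OF cores chi n] by (intro ballI)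
    show ?third
      unfolding \<omega>_def using mps_third_moment[OF cores chi n] by (intro ballI)
    show ?composition
      unfolding Let_def by (intro allI impI) (rule composition_moments[OF _ refl])
    show ?variance
      unfolding Let_def \<omega>_def
      using mps_quad_form_variance[OF cores \<open>d \<ge> 1\<close> chi n] by (intro ballI conjI)
  qed
qed

end
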